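(* Assume that there exist four or more (pairwise distinct) states $x_0,x_1^1,\dots,x_1^n,x_2\in\mathcal{X}$, $n\in\mathbb{N}$, such that $\mathcal{X}^s=\{x_0\}$, $\mathcal{X}^m=\{x_1^1,\dots,x_1^n,x_2\}$, and $H(x_2)>H(x_1^r)$, $H(x_1^r)=H(x_1^q)$, $\Phi(x_1^r,x_1^q)-H(x_1^r)<\Gamma_m$ for every $r,q=1,\dots,n$. Assume moreover that there exist two positive constants $k_1,k_2<\infty$ such that, as $\beta\to\infty$, $$\frac{\mu_\beta(x_2)}{\mathrm{cap}_\beta(x_2,\{x_1^1,\dots,x_1^n,x_0\})}=\frac1{k_1}e^{\beta\Gamma_m}[1+o(1)],\qquad \frac{\mu_\beta(\{x_1^1,\dots,x_1^n\})}{\mathrm{cap}_\beta(\{x_1^1,\dots,x_1^n\},x_0)}=\frac1{k_2}e^{\beta\Gamma_m}[1+o(1)].$$ Then, as $\beta\to\infty$, $$\mathbb{E}_{x_2}[\tau_{\{x_1^1,\dots,x_1^n,x_0\}}]=e^{\beta\Gamma_m}\frac1{k_1}[1+o(1)],\qquad \mathbb{E}_{\{x_1^1,\dots,x_1^n\}}[\tau_{x_0}]=e^{\beta\Gamma_m}\frac1{k_2}[1+o(1)].$$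
   Context: $\mathcal{X}$ is a finite set and $\Delta:\mathcal{X}\times\mathcal{X}\to\mathbb{R}^+\cup\{\infty\}$ (nonnegative values, $0$ allowed) is an irreducible rate function: for all $x,y\in\mathcal{X}$ there is a finite sequence $\omega_1=x,\dots,\omega_n=y$ with $\Delta(\omega_i,\omega_{i+1})<\infty$ for all $i$. For each $\beta>0$, $(X_n)_{n\in\mathbb{N}}$ is a time-homogeneous Markov chain on $\mathcal{X}$ with transition matrix $\mathcal{P}_\beta$, and $\lim_{\beta\to\infty}-\frac{\log\mathcal{P}_\beta(x,y)}{\beta}=\Delta(x,y)$ for all $x,y$. Detailed balance holds: $\mathcal{P}_\beta(x,y)e^{-\beta G(x)}=\mathcal{P}_\beta(y,x)e^{-\beta G(y)}$, where $G:\mathcal{X}\to\mathbb{R}$ is the Hamiltonian (possibly depending on $\beta$). The Gibbs measure is $\mu_\beta(x)=e^{-\beta G(x)}/\sum_{y\in\mathcal{X}}e^{-\beta G(y)}$. The virtual energy is $H(x):=\lim_{\beta\to\infty}G(x)$. The transition energy is $H(x,y):=H(x)+\Delta(x,y)$. A path is a finite sequence $\omega=(\omega_1,\dots,\omega_n)$ in $\mathcal{X}$; its height is $\Phi_\omega=H(\omega_1)$ if $|\omega|=1$ and $\Phi_\omega=\max_{i<|\omega|}H(\omega_i,\omega_{i+1})$ if $|\omega|>1$. The communication height is $\Phi(x,y):=\min_{\omega}\Phi_\omega$ over all paths from $x$ to $y$, and $\Phi(A,B):=\min_{x\in A,y\in B}\Phi(x,y)$ for sets. Let $\mathcal{I}_x:=\{y\mid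 H(y)<H(x)\}$ and $V_x:=\Phi(x,\mathcal{I}_x)-H(x)$, with $V_x=\infty$ if $\mathcal{I}_x=\emptyset$. $\mathcal{X}^s$ is the set of global minima of $H$, $\Gamma_m:=\max_{x\in\mathcal{X}\setminus\mathcal{X}^s}V_x$ and $\mathcal{X}^m:=\{y\in\mathcal{X}\mid V_y=\Gamma_m\}$. The Dirichlet form is $\mathscr{D}_\beta[f]:=\frac12\sum_{y,z\in\mathcal{X}}\mu_\beta(y)\mathcal{P}_\beta(y,z)[f(y)-f(z)]^2$. For nonempty disjoint $Y,Z\subset\mathcal{X}$, $\mathrm{cap}_\beta(Y,Z):=\min\{\mathscr{D}_\beta[f]: f:\mathcal{X}\to[0,1],\ f|_Y=1,\ f|_Z=0\}$; singletons are written without braces. $\tau_A:=\inf\{t>0\mid X_t\in A\}$ is the first hitting time of $A$ and $\mathbb{E}_x$ is expectation for the chain started at $x$. $\mathbb{E}_{\{x_1^1,\dots,x_1^n\}}[\tau_{x_0}]$ denotes the mean hitting time of $x_0$ starting from any state in $\{x_1^1,\dots,x_1^n\}$, i.e. the formula holds for each choice of starting state in that set. *)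

theory Defs
  imports "HOL-Probability.Probability" "HOL-Library.Landau_Symbols"
begin

section \<open>Energy landscape\<close>

text \<open>A path is a nonempty list over the finite state space, which is a type of class
  \<open>finite\<close>; consecutive states are not required to satisfy \<open>\<Delta> x y < \<infinity>\<close>.
  Energies of transitions take values in the extended reals.\<close>

definition paths :: "'x \<Rightarrow> 'x \<Rightarrow> 'x list set" where
  "paths x y = {\<omega>. \<omega> \<noteq> [] \<and> hd \<omega> = x \<and> last \<omega> = y}"

definition irreducible_rate :: "('x \<Rightarrow> 'x \<Rightarrow> ereal) \<Rightarrow> bool" where
  "irreducible_rate \<Delta> \<longleftrightarrow>
     (\<forall>x y. 0 \<le> \<Delta> x y) \<and>
     (\<forall>x y. \<exists>\<omega> \<in> paths x y. \<forall>i. Suc i < length \<omega> \<longrightarrow> \<Delta> (\<omega> ! i) (\<omega> ! Suc i) < \<infinity>)"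

definition transition_energy :: "('x \<Rightarrow> 'x \<Rightarrow> ereal) \<Rightarrow> ('x \<Rightarrow> real) \<Rightarrow> 'x \<Rightarrow> 'x \<Rightarrow> ereal" where
  "transition_energy \<Delta> H x y = ereal (H x) + \<Delta> x y"

definition path_height :: "('x \<Rightarrow> 'x \<Rightarrow> ereal) \<Rightarrow> ('x \<Rightarrow> real) \<Rightarrow> 'x list \<Rightarrow> ereal" where
  "path_height \<Delta> H \<omega> =
     (if length \<omega> = 1 then ereal (H (hd \<omega>))
      else Max {transition_energy \<Delta> H (\<omega> ! i) (\<omega> ! Suc i) | i. Suc i < length \<omega>})"

text \<open>There are infinitely many paths but only finitely many heights, so the infimum is a minimum.\<close>

definition comm_height :: "('x \<Rightarrow> 'x \<Rightarrow> ereal) \<Rightarrow> ('x \<Rightarrow> real) \<Rightarrow> 'x \<Rightarrow> 'x \<Rightarrow> ereal" where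
  "comm_height \<Delta> H x y = (INF \<omega> \<in> paths x y. path_height \<Delta> H \<omega>)"

definition comm_height_set ::
  "('x \<Rightarrow> 'x \<Rightarrow> ereal) \<Rightarrow> ('x \<Rightarrow> real) \<Rightarrow> 'x set \<Rightarrow> 'x set \<Rightarrow> ereal" where
  "comm_height_set \<Delta> H A B = (INF x \<in> A. INF y \<in> B. comm_height \<Delta> H x y)"

definition lower_states :: "('x \<Rightarrow> real) \<Rightarrow> 'x \<Rightarrow> 'x set" where
  "lower_states H x = {y. H y < H x}"

definition stability_level ::
  "('x \<Rightarrow> 'x \<Rightarrow> ereal) \<Rightarrow> ('x \<Rightarrow> real) \<Rightarrow> 'x \<Rightarrow> ereal" where
  "stability_level \<Delta> H x =
     (if lower_states H x = {} then \<infinity>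
      else comm_height_set \<Delta> H {x} (lower_states H x) - ereal (H x))"

definition stable_states :: "('x \<Rightarrow> real) \<Rightarrow> 'x set" where
  "stable_states H = {x. \<forall>y. H x \<le> H y}"

text \<open>For irreducible \<open>\<Delta>\<close> this is a finite number as soon as some state is not stable.\<close>

definition max_stability_level ::
  "('x::finite \<Rightarrow> 'x \<Rightarrow> ereal) \<Rightarrow> ('x \<Rightarrow> real) \<Rightarrow> ereal" where
  "max_stability_level \<Delta> H = Max (stability_level \<Delta> H ` (UNIV - stable_states H))"

definition metastable_states ::
  "('x::finite \<Rightarrow> 'x \<Rightarrow> ereal) \<Rightarrow> ('x \<Rightarrow> real) \<Rightarrow> 'x set" where
  "metastable_states \<Delta> H = {y. stability_level \<Delta> H y = max_stability_level \<Delta> H}"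


section \<open>Gibbs measure, Dirichlet form and capacity\<close>

text \<open>In this section \<open>G\<close> and \<open>P\<close> are the Hamiltonian and the transition matrix at the
  given value of \<open>\<beta>\<close>.\<close>

definition gibbs :: "real \<Rightarrow> ('x::finite \<Rightarrow> real) \<Rightarrow> 'x \<Rightarrow> real" where
  "gibbs \<beta> G x = exp (- \<beta> * G x) / (\<Sum>y\<in>UNIV. exp (- \<beta> * G y))"

definition gibbs_set :: "real \<Rightarrow> ('x::finite \<Rightarrow> real) \<Rightarrow> 'x set \<Rightarrow> real" where
  "gibbs_set \<beta> G A = (\<Sum>x\<in>A. gibbs \<beta> G x)"

definition dirichlet_form ::
  "real \<Rightarrow> ('x::finite \<Rightarrow> real) \<Rightarrow> ('x \<Rightarrow> 'x \<Rightarrow> real) \<Rightarrow> ('x \<Rightarrow> real) \<Rightarrow> real" where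
  "dirichlet_form \<beta> G P f =
     1 / 2 * (\<Sum>y\<in>UNIV. \<Sum>z\<in>UNIV. gibbs \<beta> G y * P y z * (f y - f z)\<^sup>2)"

text \<open>The infimum is attained, since the admissible functions form a compact set.\<close>

definition capacity ::
  "real \<Rightarrow> ('x::finite \<Rightarrow> real) \<Rightarrow> ('x \<Rightarrow> 'x \<Rightarrow> real) \<Rightarrow> 'x set \<Rightarrow> 'x set \<Rightarrow> real" where
  "capacity \<beta> G P Y Z =
     (INF f \<in> {f. (\<forall>x. 0 \<le> f x \<and> f x \<le> 1) \<and> (\<forall>y\<in>Y. f y = 1) \<and> (\<forall>z\<in>Z. f z = 0)}.
        dirichlet_form \<beta> G P f)"


section \<open>Markov chains and hitting times\<close>

definition stochastic_matrix :: "('x::finite \<Rightarrow> 'x \<Rightarrow> real) \<Rightarrow> bool" where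
  "stochastic_matrix P \<longleftrightarrow> (\<forall>x y. 0 \<le> P x y) \<and> (\<forall>x. (\<Sum>y\<in>UNIV. P x y) = 1)"

definition markov_chain_from ::
  "'w measure \<Rightarrow> (nat \<Rightarrow> 'w \<Rightarrow> 'x) \<Rightarrow> ('x \<Rightarrow> 'x \<Rightarrow> real) \<Rightarrow> 'x \<Rightarrow> bool" where
  "markov_chain_from M X P x \<longleftrightarrow>
     prob_space M \<and>
     (\<forall>n. X n \<in> measurable M (count_space UNIV)) \<and>
     (AE \<omega> in M. X 0 \<omega> = x) \<and>
     (\<forall>n h y. \<P>(\<omega> in M. \<forall>i\<le>n. X i \<omega> = h i) > 0 \<longrightarrow>
        \<P>(\<omega> in M. X (Suc n) \<omega> = y \<bar> \<forall>i\<le>n. X i \<omega> = h i) = P (h n) y)"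

text \<open>Hitting times ignore time \<open>0\<close>; the infimum of the empty set is \<open>\<infinity>\<close>.\<close>

definition hitting_time :: "(nat \<Rightarrow> 'w \<Rightarrow> 'x) \<Rightarrow> 'x set \<Rightarrow> 'w \<Rightarrow> ennreal" where
  "hitting_time X A \<omega> = (INF t \<in> {t. 0 < t \<and> X t \<omega> \<in> A}. of_nat t)"

definition mean_hitting_time :: "'w measure \<Rightarrow> (nat \<Rightarrow> 'w \<Rightarrow> 'x) \<Rightarrow> 'x set \<Rightarrow> ennreal" where
  "mean_hitting_time M X A = (\<integral>\<^sup>+ \<omega>. hitting_time X A \<omega> \<partial>M)"


section \<open>Reversible chains with exponentially small transition probabilities\<close>

text \<open>The quantity \<open>- log p / \<beta>\<close> with the convention \<open>log 0 = -\<infinity>\<close>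
  (whereas \<open>ln 0 = 0\<close> for the real logarithm).\<close>

definition log_rate :: "real \<Rightarrow> real \<Rightarrow> ereal" where
  "log_rate \<beta> p = (if p = 0 then \<infinity> else ereal (- ln p / \<beta>))"

locale reversible_rate_chain =
  fixes \<Delta> :: "'x::finite \<Rightarrow> 'x \<Rightarrow> ereal"
    and P :: "real \<Rightarrow> 'x \<Rightarrow> 'x \<Rightarrow> real"
    and G :: "real \<Rightarrow> 'x \<Rightarrow> real"
    and H :: "'x \<Rightarrow> real"
  assumes irreducible: "irreducible_rate \<Delta>"
    and stochastic: "\<And>\<beta>. \<beta> > 0 \<Longrightarrow> stochastic_matrix (P \<beta>)"
    and rate: "\<And>x y. ((\<lambda>\<beta>. log_rate \<beta> (P \<beta> x y)) \<longlongrightarrow> \<Delta> x y) at_top"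
    and detailed_balance:
      "\<And>\<beta> x y. \<beta> > 0 \<Longrightarrow> P \<beta> x y * exp (- \<beta> * G \<beta> x) = P \<beta> y x * exp (- \<beta> * G \<beta> y)"
    and virtual_energy: "\<And>x. ((\<lambda>\<beta>. G \<beta> x) \<longlongrightarrow> H x) at_top"

end

theory Submission
  imports Defs
begin

text \<open>Fix disjoint nonempty sets \<open>Y\<close> and \<open>A\<close>, let \<open>h\<close> be the function that is \<open>1\<close> on \<open>Y\<close>, \<open>0\<close> on \<open>A\<close>
  and harmonic elsewhere, and let \<open>u\<close> be the mean hitting time of \<open>A\<close>. Green's formula for the pair
  \<open>(h, u)\<close> says that an average of \<open>u\<close> over \<open>Y\<close> equals \<open>(\<Sum>x. \<mu> x * h x) / cap Y A\<close>.

  If \<open>x\<close> is joined to \<open>A\<close> by edges of conductance at least \<open>c\<close>, then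
  \<open>h x \<le> C * cap Y A / c\<close>. States outside \<open>Y \<union> A\<close> that are not higher than \<open>Y\<close> have stability level
  less than \<open>\<Gamma>\<close>, so they descend to \<open>A\<close> through edges of conductance much larger than
  \<open>\<mu> x * exp (- \<beta> * \<Gamma>)\<close>, and since \<open>cap Y A\<close> is of order \<open>\<mu> Y * exp (- \<beta> * \<Gamma>)\<close> by assumption,
  \<open>\<mu> x * h x\<close> is negligible compared to \<open>\<mu> Y\<close>. The same bound shows that a chain started in one state
  of \<open>Y\<close> visits any other one before \<open>A\<close> with probability tending to \<open>1\<close>. Hence \<open>u\<close> is asymptotically
  constant on \<open>Y\<close>, with value \<open>\<mu> Y / cap Y A\<close>. The theorem is the case \<open>Y = {x\<^sub>2}\<close> together with the
  case where \<open>Y\<close> consists of the \<open>x\<^sub>1\<close>.\<close>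

section \<open>Potential theory of a finite reversible chain\<close>

text \<open>The chain at one fixed value of \<beta>, with \<open>\<mu>\<close> standing for its
  Gibbs measure. Irreducibility is phrased as reachability, the form in which the minimum principle
  propagates.\<close>

locale reversible_matrix =
  fixes P :: "'x::finite \<Rightarrow> 'x \<Rightarrow> real" and \<mu> :: "'x \<Rightarrow> real"
  assumes P_nonneg: "0 \<le> P x y"
    and P_sum: "(\<Sum>y\<in>UNIV. P x y) = 1"
    and \<mu>_pos: "0 < \<mu> x"
    and reversible: "\<mu> x * P x y = \<mu> y * P y x"
    and P_irreducible: "(x, y) \<in> {(a, b). 0 < P a b}\<^sup>*"
begin

text \<open>This is \<open>I - P\<close>, minus the generator, so that superharmonic means
  \<open>0 \<le> lap f x\<close>.\<close>

definition lap :: "('x \<Rightarrow> real) \<Rightarrow> 'x \<Rightarrow> real" where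
  "lap f x = f x - (\<Sum>y\<in>UNIV. P x y * f y)"

text \<open>The Dirichlet form, polarised so that Green's formula can be applied to two different
  functions.\<close>

definition energy :: "('x \<Rightarrow> real) \<Rightarrow> ('x \<Rightarrow> real) \<Rightarrow> real" where
  "energy f g = 1 / 2 * (\<Sum>y\<in>UNIV. \<Sum>z\<in>UNIV. \<mu> y * P y z * ((f y - f z) * (g y - g z)))"

lemma lap_diff: "lap (\<lambda>x. f x - g x) x = lap f x - lap g x"
  by (simp add: lap_def right_diff_distrib sum_subtractf)

lemma lap_cmult: "lap (\<lambda>x. c * f x) x = c * lap f x"
  by (simp add: lap_def sum_distrib_left algebra_simps)

lemma lap_const: "lap (\<lambda>x. c) x = 0"
  by (simp add: lap_def P_sum flip: sum_distrib_right)

lemma lap_minus: "lap (\<lambda>x. - f x) x = - lap f x"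
  using lap_cmult[of "-1" f x] by simp

text \<open>At a minimum point outside \<open>B\<close> the mean over the neighbours is at most the
  minimum, so every neighbour is a minimum point too. By irreducibility a negative minimum would
  spread to \<open>B\<close>, where \<open>v\<close> is nonnegative.\<close>

lemma minimum_principle:
  assumes B: "B \<noteq> {}" and nonneg: "\<And>x. x \<in> B \<Longrightarrow> 0 \<le> v x"
    and super: "\<And>x. x \<notin> B \<Longrightarrow> 0 \<le> lap v x"
  shows "0 \<le> v x"
proof (rule ccontr)
  assume "\<not> 0 \<le> v x"
  define m where "m = Min (range v)"
  have m_le: "m \<le> v y" for y by (simp add: m_def)
  have m_neg: "m < 0" using m_le[of x] \<open>\<not> 0 \<le> v x\<close> by linarith
  have "m \<in> range v" unfolding m_def by (rule Min_in) auto
  then obtain x' where x': "v x' = m" by auto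
  have step: "v b = m" if a: "v a = m" and ab: "0 < P a b" for a b
  proof -
    have "a \<notin> B" using nonneg m_neg a by fastforce
    from super[OF this] have "(\<Sum>y\<in>UNIV. P a y * v y) \<le> m" using a by (simp add: lap_def)
    then have "(\<Sum>y\<in>UNIV. P a y * (v y - m)) \<le> 0"
      by (simp add: right_diff_distrib sum_subtractf P_sum flip: sum_distrib_right)
    moreover have nn: "0 \<le> P a y * (v y - m)" for y using m_le P_nonneg by simp
    ultimately have "(\<Sum>y\<in>UNIV. P a y * (v y - m)) = 0"
      by (meson order_antisym sum_nonneg)
    then have "P a b * (v b - m) = 0" using nn by (subst (asm) sum_nonneg_eq_0_iff) auto
    then show ?thesis using ab by simp
  qed
  obtain b where b: "b \<in> B" using B by blast
  have "v b = m" using P_irreducible[of x' b]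
    by (induction rule: rtrancl_induct) (use x' step in auto)
  with nonneg[OF b] m_neg show False by simp
qed

text \<open>The map \<open>T\<close> that keeps values on \<open>B\<close> and applies
  \<open>lap\<close> elsewhere is linear and, by the minimum principle for \<open>v\<close> and
  \<open>- v\<close>, injective, hence surjective in finite dimension. One function \<open>f\<close>
  carries both the boundary values and the source term.\<close>

lemma dirichlet_problem:
  assumes B: "B \<noteq> {}"
  obtains v where "\<And>x. x \<in> B \<Longrightarrow> v x = f x" and "\<And>x. x \<notin> B \<Longrightarrow> lap v x = f x"
proof -
  define T :: "real ^ 'x \<Rightarrow> real ^ 'x"
    where "T v = (\<chi> x. if x \<in> B then v $ x else lap (\<lambda>y. v $ y) x)" for v
  have lin: "linear T"
    by (rule linearI)
      (auto simp: T_def vec_eq_iff lap_def algebra_simps sum.distrib sum_distrib_left)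
  have "inj T"
  proof (subst linear_injective_0[OF lin], intro allI impI)
    fix v assume "T v = 0"
    then have *: "(if x \<in> B then v $ x else lap (\<lambda>y. v $ y) x) = 0" for x
      by (simp add: T_def vec_eq_iff)
    have "0 \<le> v $ x" for x
      by (rule minimum_principle[OF B]) (metis * order_refl)+
    moreover have "0 \<le> - (v $ x)" for x
      by (rule minimum_principle[OF B]) (metis * order_refl lap_minus neg_0_equal_iff_equal)+
    ultimately show "v = 0" by (simp add: vec_eq_iff order_antisym)
  qed
  then have "surj T" using lin linear_injective_imp_surjective by blast
  then obtain v where v: "T v = (\<chi> x. f x)" by (metis surjD)
  then have "(if x \<in> B then v $ x else lap (\<lambda>y. v $ y) x) = f x" for x
    by (simp add: T_def vec_eq_iff)
  then show ?thesis by (intro that[of "\<lambda>x. v $ x"]) metis+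
qed

section \<open>Dirichlet form and Green's formula\<close>

lemma energy_commute: "energy f g = energy g f"
  by (simp add: energy_def mult_ac)

lemma energy_nonneg: "0 \<le> energy f f"
  unfolding energy_def using P_nonneg \<mu>_pos by (simp add: sum_nonneg less_imp_le)

text \<open>Reversibility makes the conductances \<open>\<mu> y * P y z\<close> symmetric, so
  exchanging the summation variables turns the \<open>f z\<close> half of the sum into the
  \<open>f y\<close> half, which absorbs the factor 1/2.\<close>

lemma green: "energy f g = (\<Sum>x\<in>UNIV. \<mu> x * f x * lap g x)"
proof -
  let ?c = "\<lambda>y z. \<mu> y * P y z"
  have swap: "(\<Sum>y\<in>UNIV. \<Sum>z\<in>UNIV. ?c y z * (f z * (g y - g z)))
      = (\<Sum>y\<in>UNIV. \<Sum>z\<in>UNIV. ?c y z * (f y * (g z - g y)))"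
    by (subst sum.swap) (simp add: reversible)
  have "2 * energy f g = (\<Sum>y\<in>UNIV. \<Sum>z\<in>UNIV. ?c y z * (f y * (g y - g z)))
      - (\<Sum>y\<in>UNIV. \<Sum>z\<in>UNIV. ?c y z * (f z * (g y - g z)))"
    by (simp add: energy_def algebra_simps sum_subtractf sum.distrib)
  also have "\<dots> = 2 * (\<Sum>y\<in>UNIV. \<Sum>z\<in>UNIV. ?c y z * (f y * (g y - g z)))"
    unfolding swap by (simp add: algebra_simps sum_subtractf sum.distrib)
  finally have *: "energy f g = (\<Sum>y\<in>UNIV. \<Sum>z\<in>UNIV. ?c y z * (f y * (g y - g z)))" by simp
  have "(\<Sum>z\<in>UNIV. ?c y z * (f y * (g y - g z))) = \<mu> y * f y * lap g y" for y
  proof -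
    have "(\<Sum>z\<in>UNIV. ?c y z * (f y * (g y - g z)))
        = \<mu> y * f y * (\<Sum>z\<in>UNIV. P y z * (g y - g z))"
      by (simp add: sum_distrib_left mult_ac)
    also have "(\<Sum>z\<in>UNIV. P y z * (g y - g z)) = lap g y"
      by (simp add: lap_def right_diff_distrib sum_subtractf P_sum flip: sum_distrib_right)
    finally show ?thesis .
  qed
  with * show ?thesis by simp
qed

lemma energy_edge: "\<mu> a * P a b * (f a - f b)\<^sup>2 \<le> 2 * energy f f"
proof -
  have nn: "0 \<le> \<mu> y * P y z * ((f y - f z) * (f y - f z))" for y z
    using P_nonneg \<mu>_pos by (simp add: less_imp_le)
  have "\<mu> a * P a b * ((f a - f b) * (f a - f b))
      \<le> (\<Sum>z\<in>UNIV. \<mu> a * P a z * ((f a - f z) * (f a - f z)))"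
    by (rule member_le_sum) (use nn in auto)
  also have "\<dots> \<le> (\<Sum>y\<in>UNIV. \<Sum>z\<in>UNIV. \<mu> y * P y z * ((f y - f z) * (f y - f z)))"
    by (rule member_le_sum) (use nn in \<open>auto intro!: sum_nonneg\<close>)
  finally show ?thesis by (simp add: energy_def power2_eq_square)
qed

text \<open>Since every edge has conductance at least \<open>c\<close>, \<open>energy_edge\<close>
  bounds the increment of \<open>f\<close> along it by a common \<open>s\<close>. The increments of
  a path add up to at most \<open>N * s\<close>.\<close>

lemma energy_path:
  assumes path: "(x, z) \<in> R ^^ N" and c: "0 < c"
    and R: "\<And>a b. (a, b) \<in> R \<Longrightarrow> c \<le> \<mu> a * P a b"
  shows "c * (f x - f z)\<^sup>2 \<le> 2 * (real N)\<^sup>2 * energy f f"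
proof -
  define s where "s = sqrt (2 * energy f f / c)"
  have edge: "\<bar>f a - f b\<bar> \<le> s" if "(a, b) \<in> R" for a b
  proof -
    have "c * (f a - f b)\<^sup>2 \<le> 2 * energy f f"
      using mult_right_mono[OF R[OF that], of "(f a - f b)\<^sup>2"] energy_edge[of a b f] by simp
    then have "(f a - f b)\<^sup>2 \<le> 2 * energy f f / c"
      using c by (simp add: field_simps)
    then show ?thesis unfolding s_def by (metis real_sqrt_abs real_sqrt_le_iff)
  qed
  have "\<bar>f x - f z\<bar> \<le> real N * s" using path
  proof (induction N arbitrary: z)
    case (Suc N)
    then obtain y where "(x, y) \<in> R ^^ N" "(y, z) \<in> R" by auto
    with Suc.IH[of y] edge[of y z] show ?case by (simp add: algebra_simps)
  qed simp
  then have "\<bar>f x - f z\<bar>\<^sup>2 \<le> (real N * s)\<^sup>2" by (rule power_mono) simp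
  also have "\<dots> = (real N)\<^sup>2 * (2 * energy f f / c)"
    using c energy_nonneg[of f] by (simp add: s_def power_mult_distrib)
  finally show ?thesis using c by (simp add: field_simps)
qed

text \<open>For disjoint sets, \<open>h x\<close> is the probability that the chain started in
  \<open>x\<close> visits \<open>Y\<close> before \<open>A\<close>, time 0 included.\<close>

definition equilibrium_potential :: "'x set \<Rightarrow> 'x set \<Rightarrow> ('x \<Rightarrow> real) \<Rightarrow> bool" where
  "equilibrium_potential Y A h \<longleftrightarrow>
     (\<forall>y\<in>Y. h y = 1) \<and> (\<forall>z\<in>A. h z = 0) \<and> (\<forall>x. x \<notin> Y \<union> A \<longrightarrow> lap h x = 0)"

lemma equilibrium_potential_exists:
  assumes "Y \<noteq> {}" "Y \<inter> A = {}"
  obtains h where "equilibrium_potential Y A h"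
proof -
  have "Y \<union> A \<noteq> {}" using assms by simp
  \<comment> \<open>\<open>indicator Y\<close> gives the boundary values 1 and 0; being 0 off
    \<open>Y \<union> A\<close>, it also serves as the vanishing source there.\<close>
  from dirichlet_problem[OF this, of "indicator Y"] obtain h where
    "\<And>x. x \<in> Y \<union> A \<Longrightarrow> h x = indicator Y x" "\<And>x. x \<notin> Y \<union> A \<Longrightarrow> lap h x = indicator Y x"
    by blast
  with assms show ?thesis
    by (intro that[of h]) (auto simp: equilibrium_potential_def indicator_def)
qed

lemma equilibrium_potential_bounds:
  assumes h: "equilibrium_potential Y A h" and Y: "Y \<noteq> {}"
  shows "0 \<le> h x" and "h x \<le> 1"
proof -
  have B: "Y \<union> A \<noteq> {}" using Y by simp
  show "0 \<le> h x"
    by (rule minimum_principle[OF B]) (use h in \<open>auto simp: equilibrium_potential_def\<close>)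
  have "0 \<le> 1 - h x"
    by (rule minimum_principle[OF B])
      (use h in \<open>auto simp: equilibrium_potential_def lap_diff lap_const\<close>)
  then show "h x \<le> 1" by simp
qed

text \<open>Dirichlet's principle: \<open>f - h\<close> vanishes on \<open>Y \<union> A\<close> and
  \<open>lap h\<close> vanishes elsewhere, so the cross term in the expansion of
  \<open>energy f f\<close> is zero.\<close>

lemma equilibrium_potential_minimal:
  assumes h: "equilibrium_potential Y A h"
    and f: "\<And>y. y \<in> Y \<Longrightarrow> f y = 1" "\<And>z. z \<in> A \<Longrightarrow> f z = 0"
  shows "energy h h \<le> energy f f"
proof -
  define d where "d x = f x - h x" for x
  have "energy d h = 0"
    unfolding green by (rule sum.neutral) (use h f in \<open>force simp: equilibrium_potential_def d_def\<close>)
  moreover have "energy f f = energy h h + 2 * energy d h + energy d d"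
    by (simp add: energy_def d_def algebra_simps sum.distrib sum_subtractf sum_distrib_left)
  ultimately show ?thesis using energy_nonneg[of d] by simp
qed

text \<open>In Green's formula only \<open>Y\<close> contributes. With \<open>g = h\<close> this
  identifies the total charge on \<open>Y\<close> with \<open>energy h h\<close>; other levels
  \<open>t\<close> are for truncations of \<open>h\<close>.\<close>

lemma equilibrium_potential_charge:
  assumes h: "equilibrium_potential Y A h" and g: "\<And>y. y \<in> Y \<Longrightarrow> g y = t" "\<And>z. z \<in> A \<Longrightarrow> g z = 0"
  shows "energy g h = t * (\<Sum>y\<in>Y. \<mu> y * lap h y)"
proof -
  have "energy g h = (\<Sum>y\<in>Y. \<mu> y * g y * lap h y)"
    unfolding green
    by (rule sum.mono_neutral_right) (use h g in \<open>auto simp: equilibrium_potential_def\<close>)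
  then show ?thesis using g by (simp add: sum_distrib_left mult_ac)
qed

text \<open>Applying the path bound to \<open>h\<close> itself would only control \<open>(h x)\<^sup>2\<close>. The energy of \<open>h\<close>
  truncated at level \<open>t\<close> is at most \<open>t\<close> times that of \<open>h\<close>, which removes the square.\<close>

lemma equilibrium_potential_path_bound:
  assumes h: "equilibrium_potential Y A h" and Y: "Y \<noteq> {}"
    and z: "z \<in> A" and path: "(x, z) \<in> R ^^ N" and c: "0 < c"
    and R: "\<And>a b. (a, b) \<in> R \<Longrightarrow> c \<le> \<mu> a * P a b"
  shows "c * h x \<le> 2 * (real N)\<^sup>2 * energy h h"
proof (cases "h x = 0")
  case True
  then show ?thesis using energy_nonneg[of h] by simp
next
  case False
  note bounds = equilibrium_potential_bounds[OF h Y]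
  define t where "t = h x"
  define g where "g y = min (h y) t" for y
  have t: "0 < t" "t \<le> 1" using bounds[of x] False by (auto simp: t_def)
  have hY: "\<And>y. y \<in> Y \<Longrightarrow> h y = 1" and hA: "\<And>z. z \<in> A \<Longrightarrow> h z = 0"
    using h by (auto simp: equilibrium_potential_def)
  \<comment> \<open>Truncation is monotone and does not increase distances.\<close>
  have trunc: "(min a t - min b t) * (min a t - min b t) \<le> (min a t - min b t) * (a - b)" for a b
    by (cases "a \<le> b") (auto simp: min_def intro: mult_left_mono mult_left_mono_neg)
  have "energy g g \<le> energy g h"
    unfolding energy_def g_def using P_nonneg \<mu>_pos
    by (intro mult_left_mono[OF sum_mono[OF sum_mono[OF mult_left_mono[OF trunc]]]])
      (auto simp: less_imp_le)
  also have "energy g h = t * (\<Sum>y\<in>Y. \<mu> y * lap h y)"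
    by (rule equilibrium_potential_charge[OF h]) (use hY hA t in \<open>auto simp: g_def\<close>)
  also have "(\<Sum>y\<in>Y. \<mu> y * lap h y) = energy h h"
    using equilibrium_potential_charge[OF h hY hA] by simp
  finally have eg: "energy g g \<le> t * energy h h" .
  have "c * (g x - g z)\<^sup>2 \<le> 2 * (real N)\<^sup>2 * energy g g" by (rule energy_path[OF path c R])
  also have "\<dots> \<le> 2 * (real N)\<^sup>2 * (t * energy h h)" using eg by (intro mult_left_mono) auto
  \<comment> \<open>As \<open>g x = t\<close> and \<open>g z = 0\<close>, the left side carries the
    square of \<open>t\<close>. One factor cancels and the bound becomes linear in
    \<open>h x\<close>.\<close>
  finally have "t * (c * t) \<le> t * (2 * (real N)\<^sup>2 * energy h h)"
    using hA[OF z] t by (simp add: g_def t_def power2_eq_square mult_ac)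
  then show ?thesis using t by (simp add: t_def)
qed

text \<open>\<open>u\<close> is the mean hitting time of \<open>A\<close>, set to \<open>0\<close> on \<open>A\<close>.\<close>

definition hitting_system :: "'x set \<Rightarrow> ('x \<Rightarrow> real) \<Rightarrow> bool" where
  "hitting_system A u \<longleftrightarrow> (\<forall>x\<in>A. u x = 0) \<and> (\<forall>x. x \<notin> A \<longrightarrow> lap u x = 1)"

lemma hitting_system_exists:
  assumes "A \<noteq> {}"
  obtains u where "hitting_system A u" "\<And>x. 0 \<le> u x"
proof -
  from dirichlet_problem[OF assms, of "indicator (- A)"] obtain u where
    u: "\<And>x. x \<in> A \<Longrightarrow> u x = indicator (- A) x" "\<And>x. x \<notin> A \<Longrightarrow> lap u x = indicator (- A) x"
    by blast
  then have "hitting_system A u" by (auto simp: hitting_system_def)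
  moreover have "0 \<le> u x" for x by (rule minimum_principle[OF assms]) (use u in auto)
  ultimately show ?thesis by (rule that)
qed

text \<open>The energy of the pair \<open>h\<close>, \<open>u\<close> is evaluated twice: with
  \<open>lap u = 1\<close> wherever \<open>h\<close> can be nonzero, and with
  \<open>lap h = 0\<close> off \<open>Y\<close> wherever \<open>u\<close> can be nonzero.\<close>

lemma hitting_system_average:
  assumes u: "hitting_system A u" and h: "equilibrium_potential Y A h"
  shows "(\<Sum>y\<in>Y. \<mu> y * lap h y * u y) = (\<Sum>x\<in>UNIV. \<mu> x * h x)"
proof -
  have "(\<Sum>x\<in>UNIV. \<mu> x * h x) = energy h u"
    unfolding green
    by (rule sum.cong) (use u h in \<open>auto simp: hitting_system_def equilibrium_potential_def\<close>)
  also have "\<dots> = energy u h" by (rule energy_commute)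
  also have "\<dots> = (\<Sum>y\<in>Y. \<mu> y * u y * lap h y)"
    unfolding green
    by (rule sum.mono_neutral_right)
      (use u h in \<open>auto simp: hitting_system_def equilibrium_potential_def\<close>)
  finally show ?thesis by (simp add: mult_ac)
qed

text \<open>The chain visits \<open>w\<close> before \<open>A\<close> with probability
  \<open>1 - p x\<close> and then still needs time \<open>u w\<close> on average. Analytically,
  \<open>u - u w * (1 - p)\<close> vanishes on \<open>A\<close> and at \<open>w\<close> and is
  superharmonic elsewhere.\<close>

lemma hitting_system_comparison:
  assumes u: "hitting_system A u" and p: "equilibrium_potential A {w} p"
  shows "(1 - p x) * u w \<le> u x"
proof -
  have "0 \<le> u x - u w * (1 - p x)"
    by (rule minimum_principle[of "insert w A"])
      (use u p in \<open>auto simp: hitting_system_def equilibrium_potential_def lap_diff lap_cmult lap_const\<close>)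
  then show ?thesis by (simp add: mult.commute)
qed

text \<open>In the last assumption, \<open>p y\<close> is the probability that the chain started in \<open>y\<close> reaches \<open>A\<close>
  before \<open>y'\<close>.\<close>

lemma hitting_system_estimate:
  assumes u: "hitting_system A u" and u_nonneg: "\<And>x. 0 \<le> u x"
    and h: "equilibrium_potential Y A h" and w: "w \<in> Y" and cap: "0 < energy h h"
    and mass: "(\<Sum>x\<in>- Y. \<mu> x * h x) \<le> \<epsilon> * sum \<mu> Y"
    and visit: "\<And>y y'. y \<in> Y \<Longrightarrow> y' \<in> Y \<Longrightarrow> \<exists>p. equilibrium_potential A {y'} p \<and> p y \<le> \<epsilon>"
  shows "(1 - \<epsilon>) * (sum \<mu> Y / energy h h) \<le> u w"
    and "(1 - \<epsilon>) * u w \<le> (1 + \<epsilon>) * (sum \<mu> Y / energy h h)"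
proof -
  define S where "S = (\<Sum>x\<in>UNIV. \<mu> x * h x)"
  have Y: "Y \<noteq> {}" using w by auto
  note bounds = equilibrium_potential_bounds[OF h Y]
  have hY: "\<And>y. y \<in> Y \<Longrightarrow> h y = 1" and hA: "\<And>z. z \<in> A \<Longrightarrow> h z = 0"
    using h by (auto simp: equilibrium_potential_def)
  have charge: "(\<Sum>y\<in>Y. \<mu> y * lap h y) = energy h h"
    using equilibrium_potential_charge[OF h hY hA] by simp
  \<comment> \<open>Because \<open>h\<close> is at most 1, its value on \<open>Y\<close>, the
    charges are nonnegative; divided by \<open>energy h h\<close> they are the weights of the
    average of \<open>u\<close>.\<close>
  have lap_nonneg: "0 \<le> \<mu> y * lap h y" if "y \<in> Y" for y
  proof -
    have "(\<Sum>z\<in>UNIV. P y z * h z) \<le> (\<Sum>z\<in>UNIV. P y z * 1)"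
      using P_nonneg bounds by (intro sum_mono mult_left_mono) auto
    then show ?thesis using hY[OF that] \<mu>_pos[of y] by (simp add: lap_def P_sum)
  qed
  have cmp: "(1 - \<epsilon>) * u y' \<le> u y" if y: "y \<in> Y" "y' \<in> Y" for y y'
  proof -
    obtain p where p: "equilibrium_potential A {y'} p" "p y \<le> \<epsilon>" using visit[OF y] by blast
    have "(1 - \<epsilon>) * u y' \<le> (1 - p y) * u y'" using p(2) u_nonneg by (intro mult_right_mono) auto
    also have "\<dots> \<le> u y" by (rule hitting_system_comparison[OF u p(1)])
    finally show ?thesis .
  qed
  have avg: "(\<Sum>y\<in>Y. \<mu> y * lap h y * u y) = S"
    unfolding S_def by (rule hitting_system_average[OF u h])
  have "S = (\<Sum>x\<in>Y. \<mu> x * h x) + (\<Sum>x\<in>- Y. \<mu> x * h x)"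
    unfolding S_def by (subst sum.union_disjoint[symmetric]) (auto simp: Un_commute)
  also have "(\<Sum>x\<in>Y. \<mu> x * h x) = sum \<mu> Y" using hY by simp
  finally have S: "S = sum \<mu> Y + (\<Sum>x\<in>- Y. \<mu> x * h x)" .
  have S_lower: "sum \<mu> Y \<le> S" unfolding S using \<mu>_pos bounds by (simp add: sum_nonneg less_imp_le)
  have S_upper: "S \<le> (1 + \<epsilon>) * sum \<mu> Y" unfolding S using mass by (simp add: algebra_simps)
  have S_nonneg: "0 \<le> S" using S_lower \<mu>_pos by (meson less_imp_le order_trans sum_nonneg)
  \<comment> \<open>Replacing each \<open>u y\<close> in the average by a multiple of
    \<open>u w\<close> bounds \<open>u w\<close> from above. The lower bound uses \<open>cmp\<close>
    with the two states exchanged.\<close>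
  have "(\<Sum>y\<in>Y. \<mu> y * lap h y * ((1 - \<epsilon>) * u w)) \<le> S"
    unfolding avg[symmetric] by (intro sum_mono mult_left_mono cmp lap_nonneg w)
  then have "energy h h * ((1 - \<epsilon>) * u w) \<le> S" unfolding charge[symmetric] sum_distrib_right .
  also note S_upper
  finally show "(1 - \<epsilon>) * u w \<le> (1 + \<epsilon>) * (sum \<mu> Y / energy h h)"
    using cap by (simp add: field_simps)
  have "(1 - \<epsilon>) * S = (\<Sum>y\<in>Y. \<mu> y * lap h y * ((1 - \<epsilon>) * u y))"
    unfolding avg[symmetric] by (simp add: sum_distrib_left mult_ac)
  also have "\<dots> \<le> (\<Sum>y\<in>Y. \<mu> y * lap h y * u w)"
    by (intro sum_mono mult_left_mono cmp lap_nonneg w)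
  also have "\<dots> = energy h h * u w" unfolding charge[symmetric] sum_distrib_right ..
  finally have *: "(1 - \<epsilon>) * S \<le> energy h h * u w" .
  have "(1 - \<epsilon>) * sum \<mu> Y \<le> energy h h * u w"
  proof (cases "\<epsilon> \<le> 1")
    case True
    then show ?thesis using * mult_left_mono[OF S_lower, of "1 - \<epsilon>"] by simp
  next
    \<comment> \<open>Multiplying \<open>S_lower\<close> by \<open>1 - \<epsilon>\<close> would
      reverse it here, but the left side is already nonpositive.\<close>
    case False
    then have "(1 - \<epsilon>) * sum \<mu> Y \<le> 0" using \<mu>_pos
      by (simp add: mult_nonpos_nonneg sum_nonneg less_imp_le)
    also have "0 \<le> energy h h * u w" using cap u_nonneg by simp
    finally show ?thesis .
  qed
  then show "(1 - \<epsilon>) * (sum \<mu> Y / energy h h) \<le> u w" using cap by (simp add: field_simps)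
qed

end

section \<open>Mean hitting times\<close>

text \<open>The tail-sum formula: the \<open>k\<close>-th term indicates that the hitting time
  exceeds \<open>k\<close>. The range \<open>{1..k}\<close> starts at 1 because time 0 is ignored,
  so the term for \<open>k = 0\<close> is always 1.\<close>

lemma hitting_time_eq_suminf:
  "hitting_time X A \<omega> = (\<Sum>k. indicator {\<omega>. \<forall>i\<in>{1..k}. X i \<omega> \<notin> A} \<omega> :: ennreal)"
proof (cases "\<exists>t. 0 < t \<and> X t \<omega> \<in> A")
  case True
  define t where "t = (LEAST t. 0 < t \<and> X t \<omega> \<in> A)"
  have t: "0 < t" "X t \<omega> \<in> A" using LeastI_ex[OF True] by (auto simp: t_def)
  have least: "t \<le> s" if "0 < s" "X s \<omega> \<in> A" for s
    unfolding t_def by (rule Least_le) (use that in simp)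
  have "hitting_time X A \<omega> = of_nat t"
    unfolding hitting_time_def
    by (rule antisym) (use t least in \<open>auto intro!: INF_lower2 INF_greatest\<close>)
  also have "\<dots> = (\<Sum>k<t. indicator {\<omega>. \<forall>i\<in>{1..k}. X i \<omega> \<notin> A} \<omega> :: ennreal)"
  proof -
    have "\<omega> \<in> {\<omega>. \<forall>i\<in>{1..k}. X i \<omega> \<notin> A}" if "k < t" for k
    proof (intro CollectI ballI notI)
      fix i assume "i \<in> {1..k}" "X i \<omega> \<in> A"
      then show False using least[of i] that by simp
    qed
    then have "(\<Sum>k<t. indicator {\<omega>. \<forall>i\<in>{1..k}. X i \<omega> \<notin> A} \<omega> :: ennreal) = (\<Sum>k<t. 1)"
      by (intro sum.cong refl indicator_simps(1)) simp
    then show ?thesis by simp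
  qed
  also have "\<dots> = (\<Sum>k. indicator {\<omega>. \<forall>i\<in>{1..k}. X i \<omega> \<notin> A} \<omega>)"
    proof (rule suminf_finite[symmetric])
    fix k assume "k \<notin> {..<t}"
    then have "t \<in> {1..k}" using t by simp
    then show "indicator {\<omega>. \<forall>i\<in>{1..k}. X i \<omega> \<notin> A} \<omega> = (0 :: ennreal)"
      using t(2) by (intro indicator_simps(2)) blast
  qed simp
  finally show ?thesis .
next
  case False
  then have 1: "hitting_time X A \<omega> = \<top>" unfolding hitting_time_def by auto
  have 2: "(\<lambda>k. indicator {\<omega>. \<forall>i\<in>{1..k}. X i \<omega> \<notin> A} \<omega>) = (\<lambda>_. 1 :: ennreal)"
  proof (intro ext indicator_simps(1) CollectI ballI)
    fix k i :: nat assume "i \<in> {1..k}"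
    then have "0 < i" by simp
    then show "X i \<omega> \<notin> A" using False by blast
  qed
  have "(\<lambda>_::nat. 1::ennreal) sums \<top>"
    unfolding sums_def by (simp add: of_nat_tendsto_top_ennreal)
  then show ?thesis unfolding 1 2 by (simp add: sums_iff)
qed

section \<open>The chain killed on \<open>A\<close> and the tails of the hitting time\<close>

locale markov_chain_process =
  fixes M :: "'w measure" and X :: "nat \<Rightarrow> 'w \<Rightarrow> 'x::finite" and P :: "'x \<Rightarrow> 'x \<Rightarrow> real" and x :: 'x
  assumes chain: "markov_chain_from M X P x"
begin

sublocale prob_space M using chain by (simp add: markov_chain_from_def)

lemma X_measurable [measurable]: "X n \<in> measurable M (count_space UNIV)"
  using chain by (simp add: markov_chain_from_def)

text \<open>The product form also covers histories of probability zero, where the conditional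
  probability is not prescribed.\<close>

lemma cylinder_step:
  "\<P>(\<omega> in M. (\<forall>i\<le>n. X i \<omega> = h i) \<and> X (Suc n) \<omega> = y) = \<P>(\<omega> in M. \<forall>i\<le>n. X i \<omega> = h i) * P (h n) y"
proof (cases "\<P>(\<omega> in M. \<forall>i\<le>n. X i \<omega> = h i) = 0")
  case True
  have "\<P>(\<omega> in M. (\<forall>i\<le>n. X i \<omega> = h i) \<and> X (Suc n) \<omega> = y) \<le> \<P>(\<omega> in M. \<forall>i\<le>n. X i \<omega> = h i)"
    by (intro finite_measure_mono) auto
  then show ?thesis using True by (simp add: measure_le_0_iff)
next
  case False
  then have "0 < \<P>(\<omega> in M. \<forall>i\<le>n. X i \<omega> = h i)" by (simp add: zero_less_measure_iff)
  with chain have "\<P>(\<omega> in M. X (Suc n) \<omega> = y \<bar> \<forall>i\<le>n. X i \<omega> = h i) = P (h n) y"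
    unfolding markov_chain_from_def by blast
  then show ?thesis using False by (simp add: cond_prob_def field_simps conj_commute)
qed

text \<open>An event determined by the times up to \<open>n\<close> is a finite disjoint union of
  cylinders, and on each of them the one-step rule applies.\<close>

lemma markov_step:
  assumes Q: "\<And>g g'. (\<And>i. i \<le> n \<Longrightarrow> g i = g' i) \<Longrightarrow> Q g = Q g'"
  shows "\<P>(\<omega> in M. Q (\<lambda>i. X i \<omega>) \<and> X n \<omega> = y \<and> X (Suc n) \<omega> = z)
       = \<P>(\<omega> in M. Q (\<lambda>i. X i \<omega>) \<and> X n \<omega> = y) * P y z"
proof -
  \<comment> \<open>Extensional functions represent each history exactly once, which makes the
    cylinders disjoint.\<close>
  define F where "F = {g \<in> PiE {..n} (\<lambda>_. UNIV :: 'x set). Q g \<and> g n = y}"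
  have fin: "finite F" unfolding F_def by (rule finite_subset[of _ "PiE {..n} (\<lambda>_. UNIV)"]) (auto intro!: finite_PiE)
  have hist: "(Q (\<lambda>i. X i \<omega>) \<and> X n \<omega> = y) \<longleftrightarrow> (\<exists>g\<in>F. \<forall>i\<le>n. X i \<omega> = g i)" for \<omega>
  proof
    assume *: "Q (\<lambda>i. X i \<omega>) \<and> X n \<omega> = y"
    have "Q (restrict (\<lambda>i. X i \<omega>) {..n})" using * Q[of "restrict (\<lambda>i. X i \<omega>) {..n}" "\<lambda>i. X i \<omega>"] by simp
    then show "\<exists>g\<in>F. \<forall>i\<le>n. X i \<omega> = g i"
      using * by (intro bexI[of _ "restrict (\<lambda>i. X i \<omega>) {..n}"]) (auto simp: F_def)
  next
    assume "\<exists>g\<in>F. \<forall>i\<le>n. X i \<omega> = g i"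
    then obtain g where g: "g \<in> F" "\<forall>i\<le>n. X i \<omega> = g i" by blast
    then show "Q (\<lambda>i. X i \<omega>) \<and> X n \<omega> = y" using Q[of g "\<lambda>i. X i \<omega>"] by (auto simp: F_def)
  qed
  have disj: "disjoint_family_on (\<lambda>g. {\<omega> \<in> space M. (\<forall>i\<le>n. X i \<omega> = g i) \<and> R \<omega>}) F" for R
  proof (unfold disjoint_family_on_def, intro ballI impI)
    fix g g' assume *: "g \<in> F" "g' \<in> F" "g \<noteq> g'"
    have "\<exists>i\<le>n. g i \<noteq> g' i"
    proof (rule ccontr)
      assume "\<not> (\<exists>i\<le>n. g i \<noteq> g' i)"
      then have "g = g'" using *(1,2) unfolding F_def by (intro PiE_ext[of g "{..n}" "\<lambda>_. UNIV" g']) auto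
      with *(3) show False by simp
    qed
    then obtain i where "i \<le> n" "g i \<noteq> g' i" by blast
    then show "{\<omega> \<in> space M. (\<forall>i\<le>n. X i \<omega> = g i) \<and> R \<omega>}
      \<inter> {\<omega> \<in> space M. (\<forall>i\<le>n. X i \<omega> = g' i) \<and> R \<omega>} = {}" by fastforce
  qed
  have decomp: "\<P>(\<omega> in M. Q (\<lambda>i. X i \<omega>) \<and> X n \<omega> = y \<and> R \<omega>)
      = (\<Sum>g\<in>F. \<P>(\<omega> in M. (\<forall>i\<le>n. X i \<omega> = g i) \<and> R \<omega>))"
    if [measurable]: "Measurable.pred M R" for R
  proof -
    have "{\<omega> \<in> space M. Q (\<lambda>i. X i \<omega>) \<and> X n \<omega> = y \<and> R \<omega>}
        = (\<Union>g\<in>F. {\<omega> \<in> space M. (\<forall>i\<le>n. X i \<omega> = g i) \<and> R \<omega>})"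
      using hist by blast
    then show ?thesis
      by (simp only:) (intro finite_measure_finite_Union[OF fin _ disj], auto)
  qed
  have "\<P>(\<omega> in M. Q (\<lambda>i. X i \<omega>) \<and> X n \<omega> = y \<and> X (Suc n) \<omega> = z)
      = (\<Sum>g\<in>F. \<P>(\<omega> in M. \<forall>i\<le>n. X i \<omega> = g i) * P (g n) z)"
    by (subst decomp) (auto simp: cylinder_step)
  also have "\<dots> = (\<Sum>g\<in>F. \<P>(\<omega> in M. (\<forall>i\<le>n. X i \<omega> = g i) \<and> True)) * P y z"
    unfolding sum_distrib_right by (rule sum.cong) (auto simp: F_def)
  also have "(\<Sum>g\<in>F. \<P>(\<omega> in M. (\<forall>i\<le>n. X i \<omega> = g i) \<and> True)) = \<P>(\<omega> in M. Q (\<lambda>i. X i \<omega>) \<and> X n \<omega> = y)"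
    by (subst decomp[symmetric]) auto
  finally show ?thesis .
qed

text \<open>The law of the killed chain at time \<open>k\<close>. Its total mass is the probability
  that the hitting time exceeds \<open>k\<close>.\<close>

definition survival :: "'x set \<Rightarrow> nat \<Rightarrow> 'x \<Rightarrow> real" where
  "survival A k y = \<P>(\<omega> in M. (\<forall>i\<in>{1..k}. X i \<omega> \<notin> A) \<and> X k \<omega> = y)"

lemma prob_split_state:
  assumes [measurable]: "Measurable.pred M R"
  shows "\<P>(\<omega> in M. R \<omega>) = (\<Sum>y\<in>UNIV. \<P>(\<omega> in M. R \<omega> \<and> X k \<omega> = y))"
proof -
  have "{\<omega> \<in> space M. R \<omega>} = (\<Union>y\<in>UNIV. {\<omega> \<in> space M. R \<omega> \<and> X k \<omega> = y})" by auto
  then show ?thesis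
    by (simp only:) (intro finite_measure_finite_Union, auto simp: disjoint_family_on_def)
qed

lemma survival_0: "survival A 0 y = (if y = x then 1 else 0)"
proof -
  have "AE \<omega> in M. X 0 \<omega> = x" using chain by (simp add: markov_chain_from_def)
  then have "survival A 0 y = \<P>(\<omega> in M. x = y)"
    unfolding survival_def by (intro finite_measure_eq_AE) auto
  then show ?thesis by (auto simp: prob_space)
qed

lemma survival_Suc:
  "survival A (Suc k) z = (if z \<in> A then 0 else \<Sum>y\<in>UNIV. survival A k y * P y z)"
proof (cases "z \<in> A")
  case True
  then have "{\<omega> \<in> space M. (\<forall>i\<in>{1..Suc k}. X i \<omega> \<notin> A) \<and> X (Suc k) \<omega> = z} = {}" by auto
  then show ?thesis using True unfolding survival_def by (simp only: measure_empty if_True)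
next
  case False
  have "survival A (Suc k) z = \<P>(\<omega> in M. (\<forall>i\<in>{1..k}. X i \<omega> \<notin> A) \<and> X (Suc k) \<omega> = z)"
    unfolding survival_def
    by (rule arg_cong[where f = "measure M"]) (use False in \<open>auto simp: atLeastAtMostSuc_conv\<close>)
  also have "\<dots> = (\<Sum>y\<in>UNIV. \<P>(\<omega> in M. (\<forall>i\<in>{1..k}. X i \<omega> \<notin> A) \<and> X k \<omega> = y \<and> X (Suc k) \<omega> = z))"
    by (subst prob_split_state[where k = k]) (auto simp: conj_ac)
  also have "\<dots> = (\<Sum>y\<in>UNIV. survival A k y * P y z)"
    unfolding survival_def
    by (intro sum.cong refl markov_step[where Q = "\<lambda>g. \<forall>i\<in>{1..k}. g i \<notin> A"]) auto
  finally show ?thesis using False by simp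
qed

lemma survival_nonneg: "0 \<le> survival A k y"
  by (simp add: survival_def)

lemma prob_survival: "\<P>(\<omega> in M. \<forall>i\<in>{1..k}. X i \<omega> \<notin> A) = (\<Sum>y\<in>UNIV. survival A k y)"
  unfolding survival_def by (rule prob_split_state) measurable

text \<open>Pairing the killed law with \<open>u\<close> gives \<open>r k = p k + r (Suc k)\<close>,
  so the tail probabilities \<open>p\<close> telescope to \<open>u x\<close> minus a remainder. The
  start lies outside \<open>A\<close> because \<open>u\<close> is 0 on \<open>A\<close> whereas
  return times are positive.\<close>

lemma mean_hitting_time_eq:
  assumes u_nonneg: "\<And>y. 0 \<le> u y" and uA: "\<And>y. y \<in> A \<Longrightarrow> u y = 0"
    and u: "\<And>y. y \<notin> A \<Longrightarrow> u y = 1 + (\<Sum>z\<in>UNIV. P y z * u z)" and x: "x \<notin> A"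
  shows "mean_hitting_time M X A = ennreal (u x)"
proof -
  define p where "p k = (\<Sum>y\<in>UNIV. survival A k y)" for k
  define r where "r k = (\<Sum>y\<in>UNIV. survival A k y * u y)" for k
  have p_nonneg: "0 \<le> p k" for k by (simp add: p_def sum_nonneg survival_nonneg)
  have r_nonneg: "0 \<le> r k" for k by (simp add: r_def sum_nonneg survival_nonneg u_nonneg)
  have off: "survival A k y = 0" if "y \<in> A" for k y
    using that x by (cases k) (auto simp: survival_0 survival_Suc)
  have rec: "r k = p k + r (Suc k)" for k
  proof -
    have "r k = (\<Sum>y\<in>UNIV. survival A k y * (1 + (\<Sum>z\<in>UNIV. P y z * u z)))"
      unfolding r_def
    proof (rule sum.cong[OF refl])
      fix y
      show "survival A k y * u y = survival A k y * (1 + (\<Sum>z\<in>UNIV. P y z * u z))"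
        by (cases "y \<in> A") (simp_all only: off u mult_zero_left not_False_eq_True)
    qed
    also have "\<dots> = p k + (\<Sum>y\<in>UNIV. \<Sum>z\<in>UNIV. survival A k y * P y z * u z)"
      by (simp add: p_def distrib_left sum.distrib sum_distrib_left mult_ac)
    also have "(\<Sum>y\<in>UNIV. \<Sum>z\<in>UNIV. survival A k y * P y z * u z)
        = (\<Sum>z\<in>UNIV. (\<Sum>y\<in>UNIV. survival A k y * P y z) * u z)"
      by (subst sum.swap) (simp add: sum_distrib_right)
    also have "\<dots> = r (Suc k)"
      unfolding r_def by (rule sum.cong) (auto simp: survival_Suc uA)
    finally show ?thesis .
  qed
  have partial: "(\<Sum>k<n. p k) = u x - r n" for n
  proof (induction n)
    case 0
    have "r 0 = u x" unfolding r_def by (subst sum.remove[of _ x]) (auto simp: survival_0)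
    then show ?case by simp
  next
    case (Suc n)
    then show ?case using rec[of n] by simp
  qed
  \<comment> \<open>The remainder is nonnegative, so the partial sums are at most
    \<open>u x\<close>. Summability forces \<open>p\<close> to 0, and \<open>r\<close>, bounded by a
    multiple of \<open>p\<close>, follows.\<close>
  have summ: "summable p"
    by (rule summableI_nonneg_bounded[where x = "u x"]) (use p_nonneg r_nonneg partial in auto)
  have r_le: "r k \<le> (\<Sum>y\<in>UNIV. u y) * p k" for k
  proof -
    have "survival A k y * u y \<le> survival A k y * (\<Sum>y\<in>UNIV. u y)" for y
      using u_nonneg by (intro mult_left_mono member_le_sum survival_nonneg) auto
    then show ?thesis unfolding r_def p_def
      by (subst mult.commute, subst sum_distrib_right) (rule sum_mono)
  qed
  have "r \<longlonglongrightarrow> 0"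
  proof (rule tendsto_sandwich)
    show "\<forall>\<^sub>F k in sequentially. 0 \<le> r k" using r_nonneg by simp
    show "\<forall>\<^sub>F k in sequentially. r k \<le> (\<Sum>y\<in>UNIV. u y) * p k" using r_le by simp
    show "(\<lambda>k. (\<Sum>y\<in>UNIV. u y) * p k) \<longlonglongrightarrow> 0"
      using tendsto_mult_right_zero[OF summable_LIMSEQ_zero[OF summ]] .
  qed simp
  then have "(\<lambda>n. u x - r n) \<longlonglongrightarrow> u x - 0" by (intro tendsto_intros)
  then have "p sums u x" unfolding sums_def partial by simp
  then have "(\<Sum>k. ennreal (p k)) = ennreal (u x)"
    using p_nonneg summ by (simp add: suminf_ennreal2 sums_iff)
  moreover have "mean_hitting_time M X A = (\<Sum>k. ennreal (p k))"
  proof -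
    have "mean_hitting_time M X A
        = (\<integral>\<^sup>+ \<omega>. (\<Sum>k. indicator {\<omega> \<in> space M. \<forall>i\<in>{1..k}. X i \<omega> \<notin> A} \<omega>) \<partial>M)"
      unfolding mean_hitting_time_def hitting_time_eq_suminf
      by (rule nn_integral_cong) (auto simp: indicator_def)
    also have "\<dots> = (\<Sum>k. \<integral>\<^sup>+ \<omega>. indicator {\<omega> \<in> space M. \<forall>i\<in>{1..k}. X i \<omega> \<notin> A} \<omega> \<partial>M)"
      by (rule nn_integral_suminf) measurable
    also have "\<dots> = (\<Sum>k. ennreal (p k))"
      by (subst nn_integral_indicator) (auto simp: p_def emeasure_eq_measure simp flip: prob_survival)
    finally show ?thesis .
  qed
  ultimately show ?thesis by simp
qed

end

section \<open>Reachability below an energy level\<close>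

text \<open>The inequality is strict so that a margin remains to absorb constants at low
  temperature.\<close>

definition edges_below :: "('x \<Rightarrow> 'x \<Rightarrow> ereal) \<Rightarrow> ('x \<Rightarrow> real) \<Rightarrow> real \<Rightarrow> ('x \<times> 'x) set" where
  "edges_below \<Delta> H E = {(a, b). transition_energy \<Delta> H a b < ereal E}"

lemma edges_below_mono: "E \<le> E' \<Longrightarrow> edges_below \<Delta> H E \<subseteq> edges_below \<Delta> H E'"
  by (auto simp: edges_below_def elim!: less_le_trans)

lemma path_in_rtrancl:
  assumes ne: "\<omega> \<noteq> []" and step: "\<And>i. Suc i < length \<omega> \<Longrightarrow> (\<omega> ! i, \<omega> ! Suc i) \<in> R"
  shows "(hd \<omega>, last \<omega>) \<in> R\<^sup>*"
proof -
  have "(\<omega> ! 0, \<omega> ! i) \<in> R\<^sup>*" if "i < length \<omega>" for i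
    using that
  proof (induction i)
    case (Suc i)
    then show ?case using step[of i] by (simp add: rtrancl.rtrancl_into_rtrancl)
  qed simp
  from this[of "length \<omega> - 1"] show ?thesis using ne by (simp add: hd_conv_nth last_conv_nth)
qed

lemma finite_transition_energies:
  "finite {transition_energy \<Delta> H (\<omega> ! i) (\<omega> ! Suc i) | i. Suc i < length \<omega>}"
  by (rule finite_subset[of _ "(\<lambda>i. transition_energy \<Delta> H (\<omega> ! i) (\<omega> ! Suc i)) ` {..<length \<omega>}"]) auto

lemma transition_energy_le_path_height:
  assumes "Suc i < length \<omega>"
  shows "transition_energy \<Delta> H (\<omega> ! i) (\<omega> ! Suc i) \<le> path_height \<Delta> H \<omega>"
  unfolding path_height_def using assms
  by (auto intro!: Max_ge[OF finite_transition_energies])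

lemma comm_height_less_imp_rtrancl:
  assumes "comm_height \<Delta> H x z < ereal E"
  shows "(x, z) \<in> (edges_below \<Delta> H E)\<^sup>*"
proof -
  from assms obtain \<omega> where \<omega>: "\<omega> \<in> paths x z" and less: "path_height \<Delta> H \<omega> < ereal E"
    unfolding comm_height_def INF_less_iff by blast
  have "(hd \<omega>, last \<omega>) \<in> (edges_below \<Delta> H E)\<^sup>*"
  proof (rule path_in_rtrancl)
    show "\<omega> \<noteq> []" using \<omega> by (simp add: paths_def)
    show "(\<omega> ! i, \<omega> ! Suc i) \<in> edges_below \<Delta> H E" if "Suc i < length \<omega>" for i
      using le_less_trans[OF transition_energy_le_path_height[OF that] less] by (simp add: edges_below_def)
  qed
  then show ?thesis using \<omega> by (simp add: paths_def)
qed

text \<open>The first transition already costs \<open>H x\<close>, as rates are nonnegative. This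
  keeps the infimum over paths away from minus infinity.\<close>

lemma path_height_ge:
  assumes \<Delta>: "irreducible_rate \<Delta>" and \<omega>: "\<omega> \<in> paths x y"
  shows "ereal (H x) \<le> path_height \<Delta> H \<omega>"
proof (cases "length \<omega> = 1")
  case True
  then show ?thesis using \<omega> by (simp add: path_height_def paths_def)
next
  case False
  then have "Suc 0 < length \<omega>" using \<omega> by (cases \<omega>) (auto simp: paths_def)
  from transition_energy_le_path_height[OF this]
  have "transition_energy \<Delta> H (\<omega> ! 0) (\<omega> ! Suc 0) \<le> path_height \<Delta> H \<omega>" .
  moreover have "\<omega> ! 0 = x" using \<omega> by (auto simp: paths_def hd_conv_nth)
  moreover have "0 \<le> \<Delta> x (\<omega> ! Suc 0)" using \<Delta> by (simp add: irreducible_rate_def)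
  then have "ereal (H x) + 0 \<le> transition_energy \<Delta> H x (\<omega> ! Suc 0)"
    unfolding transition_energy_def by (rule add_left_mono)
  ultimately show ?thesis by (simp add: order_trans)
qed

lemma comm_height_finite:
  assumes "irreducible_rate \<Delta>"
  shows "comm_height \<Delta> H x y < \<infinity>"
proof -
  from assms obtain \<omega> where \<omega>: "\<omega> \<in> paths x y"
    and fin: "\<And>i. Suc i < length \<omega> \<Longrightarrow> \<Delta> (\<omega> ! i) (\<omega> ! Suc i) < \<infinity>"
    unfolding irreducible_rate_def by meson
  have "path_height \<Delta> H \<omega> < \<infinity>"
  proof (cases "length \<omega> = 1")
    case False
    let ?S = "{transition_energy \<Delta> H (\<omega> ! i) (\<omega> ! Suc i) | i. Suc i < length \<omega>}"
    have "Suc 0 < length \<omega>" using False \<omega> by (cases \<omega>) (auto simp: paths_def)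
    then have "?S \<noteq> {}" by blast
    with finite_transition_energies have "Max ?S \<in> ?S" by (rule Max_in)
    then have "Max ?S < \<infinity>" using fin by (auto simp: transition_energy_def)
    then show ?thesis using False by (simp add: path_height_def)
  qed (simp add: path_height_def)
  then show ?thesis unfolding comm_height_def using \<omega> by (meson INF_lower le_less_trans)
qed

lemma stability_level_finite:
  assumes \<Delta>: "irreducible_rate \<Delta>" and lower: "lower_states H x \<noteq> {}"
  obtains v where "stability_level \<Delta> H x = ereal v"
proof -
  let ?h = "comm_height_set \<Delta> H {x} (lower_states H x)"
  have "ereal (H x) \<le> ?h"
    unfolding comm_height_set_def comm_height_def using path_height_ge[OF \<Delta>]
    by (auto intro!: INF_greatest)
  moreover obtain y where "y \<in> lower_states H x" using lower by blast
  then have "?h \<le> comm_height \<Delta> H x y" unfolding comm_height_set_def by (auto intro: INF_lower)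
  then have "?h < \<infinity>" using comm_height_finite[OF \<Delta>] by (rule le_less_trans)
  ultimately obtain r where "?h = ereal r" by (cases ?h) auto
  then show ?thesis using lower by (intro that[of "r - H x"]) (simp add: stability_level_def)
qed

text \<open>A state outside \<open>A\<close> reaches a strictly lower one below its own height plus
  \<open>\<Gamma>\<close>. Later thresholds only decrease, and the number of lower states drops at
  each stage, so the descent ends in \<open>A\<close>.\<close>

lemma descent:
  fixes H :: "'x::finite \<Rightarrow> real"
  assumes "\<And>y. y \<notin> A \<Longrightarrow> y = x \<or> H y < H x \<Longrightarrow> stability_level \<Delta> H y < ereal \<Gamma>"
  shows "\<exists>z\<in>A. (x, z) \<in> (edges_below \<Delta> H (H x + \<Gamma>))\<^sup>*"
  using assms
proof (induction x rule: measure_induct_rule[of "\<lambda>x. card (lower_states H x)"])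
  case (less x)
  show ?case
  proof (cases "x \<in> A")
    case False
    then have V: "stability_level \<Delta> H x < ereal \<Gamma>" using less.prems by blast
    \<comment> \<open>A global minimum has stability level infinity, so the bound by
      \<open>\<Gamma>\<close> excludes it.\<close>
    then have ne: "lower_states H x \<noteq> {}" by (auto simp: stability_level_def)
    with V have "comm_height_set \<Delta> H {x} (lower_states H x) < ereal (H x + \<Gamma>)"
      by (simp add: stability_level_def ereal_minus_less add.commute)
    then obtain y where y: "H y < H x" "comm_height \<Delta> H x y < ereal (H x + \<Gamma>)"
      by (auto simp: comm_height_set_def INF_less_iff lower_states_def)
    have "lower_states H y \<subset> lower_states H x" using y(1) by (auto simp: lower_states_def)
    then have "card (lower_states H y) < card (lower_states H x)" by (simp add: psubset_card_mono)
    then obtain z where z: "z \<in> A" "(y, z) \<in> (edges_below \<Delta> H (H y + \<Gamma>))\<^sup>*"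
      using less.IH[of y] less.prems y(1) by (metis less_trans)
    have "(edges_below \<Delta> H (H y + \<Gamma>))\<^sup>* \<subseteq> (edges_below \<Delta> H (H x + \<Gamma>))\<^sup>*"
      using y(1) by (intro rtrancl_mono edges_below_mono) simp
    then have "(y, z) \<in> (edges_below \<Delta> H (H x + \<Gamma>))\<^sup>*" using z(2) by blast
    with comm_height_less_imp_rtrancl[OF y(2)] z(1) show ?thesis by (meson rtrancl_trans)
  qed auto
qed

section \<open>Low-temperature asymptotics\<close>

lemma gibbs_pos: "0 < gibbs \<beta> G x"
  unfolding gibbs_def by (intro divide_pos_pos sum_pos) auto

lemma gibbs_set_pos: "Y \<noteq> {} \<Longrightarrow> 0 < gibbs_set \<beta> G Y"
  unfolding gibbs_set_def by (intro sum_pos gibbs_pos) auto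

lemma capacity_eq_energy:
  assumes chain: "reversible_matrix P (gibbs \<beta> G)"
    and h: "reversible_matrix.equilibrium_potential P Y A h" and Y: "Y \<noteq> {}"
  shows "capacity \<beta> G P Y A = reversible_matrix.energy P (gibbs \<beta> G) h h"
proof -
  interpret reversible_matrix P "gibbs \<beta> G" by (rule chain)
  let ?F = "{f. (\<forall>x. 0 \<le> f x \<and> f x \<le> 1) \<and> (\<forall>y\<in>Y. f y = 1) \<and> (\<forall>z\<in>A. f z = (0::real))}"
  have D: "dirichlet_form \<beta> G P f = energy f f" for f
    by (simp add: dirichlet_form_def energy_def power2_eq_square)
  have "h \<in> ?F"
    using equilibrium_potential_bounds[OF h Y] h by (auto simp: equilibrium_potential_def)
  moreover have "bdd_below ((\<lambda>f. energy f f) ` ?F)"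
    by (intro bdd_belowI[of _ 0]) (auto simp: energy_nonneg)
  ultimately have "(INF f\<in>?F. energy f f) \<le> energy h h" by (rule cINF_lower[rotated])
  moreover have "energy h h \<le> (INF f\<in>?F. energy f f)"
    using \<open>h \<in> ?F\<close> by (intro cINF_greatest equilibrium_potential_minimal[OF h]) auto
  ultimately show ?thesis unfolding capacity_def D by (rule order_antisym)
qed

section \<open>Gibbs weights and conductances at low temperature\<close>

context reversible_rate_chain
begin

text \<open>A finite limit rate forces a positive transition probability for large \<beta>. There
  are finitely many pairs, so paths of finite rate eventually become paths of positive
  probability.\<close>

lemma eventually_reversible_matrix:
  "\<forall>\<^sub>F \<beta> in at_top. reversible_matrix (P \<beta>) (gibbs \<beta> (G \<beta>))"
proof -
  have "\<forall>\<^sub>F \<beta> in at_top. \<forall>(a, b)\<in>{(a, b). \<Delta> a b < \<infinity>}. log_rate \<beta> (P \<beta> a b) < \<infinity>"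
    using order_tendstoD(2)[OF rate] by (intro eventually_ball_finite) force+
  moreover have "\<forall>\<^sub>F \<beta> in at_top. (0::real) < \<beta>" by (rule eventually_gt_at_top)
  ultimately show ?thesis
  proof eventually_elim
    case (elim \<beta>)
    have nonneg: "0 \<le> P \<beta> a b" for a b
      using stochastic[OF elim(2)] by (simp add: stochastic_matrix_def)
    have pos: "0 < P \<beta> a b" if "\<Delta> a b < \<infinity>" for a b
    proof -
      have "log_rate \<beta> (P \<beta> a b) < \<infinity>" using elim(1) that by auto
      then have "P \<beta> a b \<noteq> 0" by (auto simp: log_rate_def)
      then show ?thesis using nonneg[of a b] by simp
    qed
    show ?case
    proof
      show "0 \<le> P \<beta> x y" for x y by (rule nonneg)
      show "(\<Sum>y\<in>UNIV. P \<beta> x y) = 1" for x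
        using stochastic[OF elim(2)] by (simp add: stochastic_matrix_def)
      show "0 < gibbs \<beta> (G \<beta>) x" for x by (rule gibbs_pos)
      show "gibbs \<beta> (G \<beta>) x * P \<beta> x y = gibbs \<beta> (G \<beta>) y * P \<beta> y x" for x y
        using detailed_balance[OF elim(2), of x y] by (simp add: gibbs_def mult.commute)
      show "(x, y) \<in> {(a, b). 0 < P \<beta> a b}\<^sup>*" for x y
      proof -
        obtain \<omega> where \<omega>: "\<omega> \<in> paths x y"
          and fin: "\<And>i. Suc i < length \<omega> \<Longrightarrow> \<Delta> (\<omega> ! i) (\<omega> ! Suc i) < \<infinity>"
          using irreducible unfolding irreducible_rate_def by meson
        have "(hd \<omega>, last \<omega>) \<in> {(a, b). 0 < P \<beta> a b}\<^sup>*"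
          by (rule path_in_rtrancl) (use \<omega> fin pos in \<open>auto simp: paths_def\<close>)
        then show ?thesis using \<omega> by (simp add: paths_def)
      qed
    qed
  qed
qed

lemma eventually_gibbs_le:
  assumes less: "H y < H x" and \<epsilon>: "0 < \<epsilon>"
  shows "\<forall>\<^sub>F \<beta> in at_top. gibbs \<beta> (G \<beta>) x \<le> \<epsilon> * gibbs \<beta> (G \<beta>) y"
proof -
  \<comment> \<open>Convergence of \<open>G\<close> at \<open>x\<close> and at \<open>y\<close>
    costs \<delta> each; the remaining gap \<open>2 * \<delta>\<close>, multiplied by \<beta>,
    outweighs \<open>- ln \<epsilon>\<close>.\<close>
  define \<delta> where "\<delta> = (H x - H y) / 4"
  have \<delta>: "0 < \<delta>" "H x - H y = 4 * \<delta>" using less by (auto simp: \<delta>_def)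
  have "\<forall>\<^sub>F \<beta> in at_top. H x - \<delta> < G \<beta> x"
    using \<delta> by (intro order_tendstoD(1)[OF virtual_energy]) simp
  moreover have "\<forall>\<^sub>F \<beta> in at_top. G \<beta> y < H y + \<delta>"
    using \<delta> by (intro order_tendstoD(2)[OF virtual_energy]) simp
  moreover have "\<forall>\<^sub>F \<beta> in at_top. (0::real) < \<beta>" by (rule eventually_gt_at_top)
  moreover have "\<forall>\<^sub>F \<beta> in at_top. - ln \<epsilon> / (2 * \<delta>) \<le> \<beta>" by (rule eventually_ge_at_top)
  ultimately show ?thesis
  proof eventually_elim
    case (elim \<beta>)
    have "- ln \<epsilon> \<le> \<beta> * (2 * \<delta>)" using elim(4) \<delta> by (simp add: field_simps)
    also have "\<dots> \<le> \<beta> * (G \<beta> x - G \<beta> y)"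
      using elim(1,2,3) \<delta>(2) by (intro mult_left_mono) linarith+
    finally have "- \<beta> * G \<beta> x \<le> ln \<epsilon> + - \<beta> * G \<beta> y" by (simp add: algebra_simps)
    then have "exp (- \<beta> * G \<beta> x) \<le> exp (ln \<epsilon> + - \<beta> * G \<beta> y)" by simp
    also have "\<dots> = \<epsilon> * exp (- \<beta> * G \<beta> y)" using \<epsilon> by (simp only: exp_add exp_ln)
    finally show ?case by (simp add: gibbs_def divide_right_mono sum_nonneg)
  qed
qed

lemma eventually_edge_conductance:
  assumes edge: "(a, b) \<in> edges_below \<Delta> H (H y + \<Gamma>)" and K: "0 < K"
  shows "\<forall>\<^sub>F \<beta> in at_top. K * gibbs \<beta> (G \<beta>) y * exp (- \<beta> * \<Gamma>) \<le> gibbs \<beta> (G \<beta>) a * P \<beta> a b"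
proof -
  have less: "ereal (H a) + \<Delta> a b < ereal (H y + \<Gamma>)"
    using edge by (simp add: edges_below_def transition_energy_def)
  have "0 \<le> \<Delta> a b" using irreducible by (simp add: irreducible_rate_def)
  with less obtain d where d: "\<Delta> a b = ereal d" by (cases "\<Delta> a b") auto
  \<comment> \<open>Three quarters of the margin cover the errors in the rate, \<open>G a\<close>
    and \<open>G y\<close>; the last one absorbs \<open>ln K\<close>.\<close>
  define \<delta> where "\<delta> = (H y + \<Gamma> - H a - d) / 4"
  have \<delta>: "0 < \<delta>" using less by (simp add: \<delta>_def d)
  have "\<forall>\<^sub>F \<beta> in at_top. log_rate \<beta> (P \<beta> a b) < ereal (d + \<delta>)"
    using \<delta> by (intro order_tendstoD(2)[OF rate]) (simp add: d)
  moreover have "\<forall>\<^sub>F \<beta> in at_top. G \<beta> a < H a + \<delta>"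
    using \<delta> by (intro order_tendstoD(2)[OF virtual_energy]) simp
  moreover have "\<forall>\<^sub>F \<beta> in at_top. H y - \<delta> < G \<beta> y"
    using \<delta> by (intro order_tendstoD(1)[OF virtual_energy]) simp
  moreover have "\<forall>\<^sub>F \<beta> in at_top. (0::real) < \<beta>" by (rule eventually_gt_at_top)
  moreover have "\<forall>\<^sub>F \<beta> in at_top. ln K / \<delta> \<le> \<beta>" by (rule eventually_ge_at_top)
  ultimately show ?thesis
  proof eventually_elim
    case (elim \<beta>)
    let ?p = "P \<beta> a b"
    have "0 \<le> ?p" using stochastic[OF elim(4)] by (simp add: stochastic_matrix_def)
    then have p: "0 < ?p" and "- ln ?p / \<beta> < d + \<delta>"
      using elim(1) by (auto simp: log_rate_def split: if_splits)
    then have ln_p: "- \<beta> * (d + \<delta>) \<le> ln ?p" using elim(4) by (simp add: field_simps)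
    have "ln K \<le> \<beta> * \<delta>" using elim(5) \<delta> by (simp add: field_simps)
    also have "\<dots> \<le> \<beta> * (G \<beta> y + \<Gamma> - G \<beta> a - (d + \<delta>))"
      using elim by (intro mult_left_mono) (auto simp: \<delta>_def field_simps)
    also have "\<dots> \<le> \<beta> * (G \<beta> y + \<Gamma> - G \<beta> a) + ln ?p" using ln_p by (simp add: algebra_simps)
    finally have "ln K + - \<beta> * G \<beta> y + - \<beta> * \<Gamma> \<le> - \<beta> * G \<beta> a + ln ?p"
      by (simp add: algebra_simps)
    then have "exp (ln K + - \<beta> * G \<beta> y + - \<beta> * \<Gamma>) \<le> exp (- \<beta> * G \<beta> a + ln ?p)" by simp
    then have "K * exp (- \<beta> * G \<beta> y) * exp (- \<beta> * \<Gamma>) \<le> exp (- \<beta> * G \<beta> a) * ?p"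
      using K p by (simp only: exp_add exp_ln)
    then have "K * exp (- \<beta> * G \<beta> y) * exp (- \<beta> * \<Gamma>) / (\<Sum>y\<in>UNIV. exp (- \<beta> * G \<beta> y))
        \<le> exp (- \<beta> * G \<beta> a) * ?p / (\<Sum>y\<in>UNIV. exp (- \<beta> * G \<beta> y))"
      by (intro divide_right_mono sum_nonneg) auto
    then show ?case by (simp add: gibbs_def)
  qed
qed

text \<open>The bound for single states, taken with constant \<open>card W * K\<close> and averaged
  over \<open>W\<close>, puts the mass of all of \<open>W\<close> on the left.\<close>

lemma eventually_conductances:
  assumes W: "\<forall>y\<in>W. H y = E" "W \<noteq> {}" and K: "0 < K"
  shows "\<forall>\<^sub>F \<beta> in at_top. \<forall>(a, b)\<in>edges_below \<Delta> H (E + \<Gamma>).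
    K * gibbs_set \<beta> (G \<beta>) W * exp (- \<beta> * \<Gamma>) \<le> gibbs \<beta> (G \<beta>) a * P \<beta> a b"
proof -
  have card: "0 < real (card W)" using W(2) by (simp add: card_gt_0_iff)
  have "\<forall>\<^sub>F \<beta> in at_top. \<forall>y\<in>W. \<forall>e\<in>edges_below \<Delta> H (E + \<Gamma>).
    real (card W) * K * gibbs \<beta> (G \<beta>) y * exp (- \<beta> * \<Gamma>) \<le> gibbs \<beta> (G \<beta>) (fst e) * P \<beta> (fst e) (snd e)"
  proof (intro eventually_ball_finite ballI)
    fix y e assume y: "y \<in> W" and e: "e \<in> edges_below \<Delta> H (E + \<Gamma>)"
    have "(fst e, snd e) \<in> edges_below \<Delta> H (H y + \<Gamma>)" using e W(1) y by simp
    then show "\<forall>\<^sub>F \<beta> in at_top. real (card W) * K * gibbs \<beta> (G \<beta>) y * exp (- \<beta> * \<Gamma>)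
        \<le> gibbs \<beta> (G \<beta>) (fst e) * P \<beta> (fst e) (snd e)"
      by (rule eventually_edge_conductance) (use card K in simp)
  qed simp_all
  then show ?thesis
  proof eventually_elim
    case (elim \<beta>)
    show ?case
    proof (clarify)
      fix a b assume ab: "(a, b) \<in> edges_below \<Delta> H (E + \<Gamma>)"
      have "(\<Sum>y\<in>W. real (card W) * K * gibbs \<beta> (G \<beta>) y * exp (- \<beta> * \<Gamma>))
          \<le> (\<Sum>y\<in>W. gibbs \<beta> (G \<beta>) a * P \<beta> a b)"
        using elim ab by (intro sum_mono) force
      then have "real (card W) * (K * gibbs_set \<beta> (G \<beta>) W * exp (- \<beta> * \<Gamma>))
          \<le> real (card W) * (gibbs \<beta> (G \<beta>) a * P \<beta> a b)"
        by (simp add: gibbs_set_def sum_distrib_left sum_distrib_right mult_ac)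
      then show "K * gibbs_set \<beta> (G \<beta>) W * exp (- \<beta> * \<Gamma>) \<le> gibbs \<beta> (G \<beta>) a * P \<beta> a b"
        using card by simp
    qed
  qed
qed

text \<open>The path has a length independent of \<beta>, while its conductances exceed any fixed
  multiple of \<open>gibbs_set \<beta> (G \<beta>) W * exp (- \<beta> * \<Gamma>)\<close>. The
  function \<open>h\<close> and the mass \<open>m\<close> are quantified inside because they vary
  with \<beta>.\<close>

lemma eventually_potential_small:
  assumes W: "\<forall>y\<in>W. H y = E" "W \<noteq> {}" and B: "B \<noteq> {}" and z: "z \<in> A"
    and path: "(x, z) \<in> (edges_below \<Delta> H (E + \<Gamma>))\<^sup>*" and C: "0 < C" and \<epsilon>: "0 < \<epsilon>"
  shows "\<forall>\<^sub>F \<beta> in at_top. \<forall>h m. reversible_matrix.equilibrium_potential (P \<beta>) B A h \<longrightarrow> 0 \<le> m \<longrightarrow>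
    reversible_matrix.energy (P \<beta>) (gibbs \<beta> (G \<beta>)) h h \<le> C * exp (- \<beta> * \<Gamma>) * m \<longrightarrow>
    gibbs_set \<beta> (G \<beta>) W * h x \<le> \<epsilon> * m"
proof -
  obtain N where N: "(x, z) \<in> edges_below \<Delta> H (E + \<Gamma>) ^^ N"
    using path by (auto simp: rtrancl_power)
  \<comment> \<open>The main term makes the factor from the path bound at most
    \<open>K * \<epsilon>\<close>; adding 1 keeps \<open>K\<close> positive when
    \<open>N = 0\<close>.\<close>
  define K where "K = 2 * (real N)\<^sup>2 * C / \<epsilon> + 1"
  have K: "0 < K" using C \<epsilon> by (simp add: K_def add_nonneg_pos)
  have K\<epsilon>: "2 * (real N)\<^sup>2 * C \<le> K * \<epsilon>" using \<epsilon> by (simp add: K_def field_simps)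
  from eventually_conductances[OF W K, of \<Gamma>] eventually_reversible_matrix
  show ?thesis
  proof eventually_elim
    case (elim \<beta>)
    interpret reversible_matrix "P \<beta>" "gibbs \<beta> (G \<beta>)" by (rule elim(2))
    show ?case
    proof (intro allI impI)
      fix h and m :: real
      assume h: "equilibrium_potential B A h" and m: "0 \<le> m"
        and e: "energy h h \<le> C * exp (- \<beta> * \<Gamma>) * m"
      let ?c = "K * gibbs_set \<beta> (G \<beta>) W * exp (- \<beta> * \<Gamma>)"
      have c: "0 < ?c" using K gibbs_set_pos[OF W(2)] by simp
      have "?c * h x \<le> 2 * (real N)\<^sup>2 * energy h h"
        by (rule equilibrium_potential_path_bound[OF h B z N c]) (use elim(1) in auto)
      also have "\<dots> \<le> 2 * (real N)\<^sup>2 * (C * exp (- \<beta> * \<Gamma>) * m)" using e by (intro mult_left_mono) auto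
      also have "\<dots> = exp (- \<beta> * \<Gamma>) * (2 * (real N)\<^sup>2 * C * m)" by simp
      also have "\<dots> \<le> exp (- \<beta> * \<Gamma>) * (K * \<epsilon> * m)"
        using K\<epsilon> m by (intro mult_left_mono mult_right_mono) auto
      finally have "K * exp (- \<beta> * \<Gamma>) * (gibbs_set \<beta> (G \<beta>) W * h x) \<le> K * exp (- \<beta> * \<Gamma>) * (\<epsilon> * m)"
        by (simp add: mult_ac)
      then show "gibbs_set \<beta> (G \<beta>) W * h x \<le> \<epsilon> * m"
        by (rule mult_left_le_imp_le) (use K in simp)
    qed
  qed
qed

proposition hitting_system_asymp_equiv:
  assumes A: "A \<noteq> {}" and YA: "Y \<inter> A = {}" and k: "0 < k" and w: "w \<in> Y"
    and level: "\<forall>y\<in>Y. H y = E"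
    and connected: "\<And>y y'. y \<in> Y \<Longrightarrow> y' \<in> Y \<Longrightarrow> (y, y') \<in> (edges_below \<Delta> H (E + \<Gamma>))\<^sup>*"
    and drain: "\<And>x. x \<notin> Y \<union> A \<Longrightarrow> H x \<le> E \<Longrightarrow> \<exists>z\<in>A. (x, z) \<in> (edges_below \<Delta> H (H x + \<Gamma>))\<^sup>*"
    and asymp: "(\<lambda>\<beta>. gibbs_set \<beta> (G \<beta>) Y / capacity \<beta> (G \<beta>) (P \<beta>) Y A)
      \<sim>[at_top] (\<lambda>\<beta>. 1 / k * exp (\<beta> * \<Gamma>))"
    and u: "\<forall>\<^sub>F \<beta> in at_top. reversible_matrix.hitting_system (P \<beta>) A (u \<beta>)"
    and u_nonneg: "\<And>\<beta> x. 0 \<le> u \<beta> x"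
  shows "(\<lambda>\<beta>. u \<beta> w) \<sim>[at_top] (\<lambda>\<beta>. exp (\<beta> * \<Gamma>) * (1 / k))"
proof -
  define T where "T \<beta> = exp (\<beta> * \<Gamma>) * (1 / k)" for \<beta>
  define Q where "Q \<beta> = gibbs_set \<beta> (G \<beta>) Y / capacity \<beta> (G \<beta>) (P \<beta>) Y A" for \<beta>
  have T: "0 < T \<beta>" for \<beta> using k by (simp add: T_def)
  have Y: "Y \<noteq> {}" using w by auto
  have "Q \<sim>[at_top] T" using asymp unfolding Q_def T_def by (simp add: mult.commute)
  then have QT: "((\<lambda>\<beta>. Q \<beta> / T \<beta>) \<longlongrightarrow> 1) at_top"
    by (rule asymp_equivD_strong) (use T in \<open>simp add: less_imp_neq[THEN not_sym]\<close>)
  have cap: "\<forall>\<^sub>F \<beta> in at_top. 0 < capacity \<beta> (G \<beta>) (P \<beta>) Y A \<and>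
      capacity \<beta> (G \<beta>) (P \<beta>) Y A \<le> 2 * k * exp (- \<beta> * \<Gamma>) * gibbs_set \<beta> (G \<beta>) Y"
  proof -
    have "\<forall>\<^sub>F \<beta> in at_top. 1 / 2 < Q \<beta> / T \<beta>" by (rule order_tendstoD(1)[OF QT]) simp
    then show ?thesis
    proof eventually_elim
      case (elim \<beta>)
      let ?c = "capacity \<beta> (G \<beta>) (P \<beta>) Y A"
      have half: "T \<beta> / 2 < Q \<beta>" using elim T[of \<beta>] by (simp add: field_simps)
      then have "0 < Q \<beta>" using T[of \<beta>] by linarith
      \<comment> \<open>Division by zero gives 0, so a positive quotient already excludes a
        vanishing capacity.\<close>
      then have c: "0 < ?c"
        using gibbs_set_pos[OF Y, of \<beta> "G \<beta>"] by (simp add: Q_def zero_less_divide_iff)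
      with half have "T \<beta> * ?c \<le> 2 * gibbs_set \<beta> (G \<beta>) Y" by (simp add: Q_def field_simps)
      then have "k * exp (- \<beta> * \<Gamma>) * (T \<beta> * ?c) \<le> k * exp (- \<beta> * \<Gamma>) * (2 * gibbs_set \<beta> (G \<beta>) Y)"
        using k by (intro mult_left_mono) auto
      moreover have "k * exp (- \<beta> * \<Gamma>) * T \<beta> = 1" using k by (simp add: T_def exp_minus)
      ultimately show ?case using c by (simp add: mult.assoc[symmetric])
    qed
  qed
  have estimate: "\<forall>\<^sub>F \<beta> in at_top. (1 - \<epsilon>) * Q \<beta> \<le> u \<beta> w \<and> (1 - \<epsilon>) * u \<beta> w \<le> (1 + \<epsilon>) * Q \<beta>"
    if \<epsilon>: "0 < \<epsilon>" for \<epsilon>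
  proof -
    \<comment> \<open>Each state may contribute this share of \<epsilon>, so that the sum over the
      complement of \<open>Y\<close> stays within \<epsilon>.\<close>
    define \<eta> where "\<eta> = \<epsilon> / real CARD('x)"
    have \<eta>: "0 < \<eta>" using \<epsilon> by (simp add: \<eta>_def)
    have "\<forall>\<^sub>F \<beta> in at_top. \<forall>h. reversible_matrix.equilibrium_potential (P \<beta>) Y A h \<longrightarrow>
        reversible_matrix.energy (P \<beta>) (gibbs \<beta> (G \<beta>)) h h
          \<le> 2 * k * exp (- \<beta> * \<Gamma>) * gibbs_set \<beta> (G \<beta>) Y \<longrightarrow>
        gibbs \<beta> (G \<beta>) x * h x \<le> \<eta> * gibbs_set \<beta> (G \<beta>) Y" if x: "x \<in> - (Y \<union> A)" for x
    proof (cases "H x \<le> E")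
      case True
      then obtain z where z: "z \<in> A" "(x, z) \<in> (edges_below \<Delta> H (H x + \<Gamma>))\<^sup>*" using drain x by auto
      have "\<forall>\<^sub>F \<beta> in at_top. \<forall>h m. reversible_matrix.equilibrium_potential (P \<beta>) Y A h \<longrightarrow> 0 \<le> m \<longrightarrow>
        reversible_matrix.energy (P \<beta>) (gibbs \<beta> (G \<beta>)) h h \<le> 2 * k * exp (- \<beta> * \<Gamma>) * m \<longrightarrow>
        gibbs_set \<beta> (G \<beta>) {x} * h x \<le> \<eta> * m"
        by (rule eventually_potential_small[OF _ _ Y z _ \<eta>]) (use k in auto)
      then show ?thesis
        by eventually_elim (use gibbs_set_pos[OF Y] in \<open>auto simp: gibbs_set_def less_imp_le\<close>)
    next
      case False
      then have "H w < H x" using level w by simp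
      from eventually_gibbs_le[OF this \<eta>] eventually_reversible_matrix
      show ?thesis
      proof eventually_elim
        case (elim \<beta>)
        interpret reversible_matrix "P \<beta>" "gibbs \<beta> (G \<beta>)" by (rule elim(2))
        show ?case
        proof (intro allI impI)
          fix h assume h: "equilibrium_potential Y A h"
          have "gibbs \<beta> (G \<beta>) x * h x \<le> gibbs \<beta> (G \<beta>) x * 1"
            using equilibrium_potential_bounds[OF h Y] by (intro mult_left_mono less_imp_le[OF gibbs_pos])
          also have "\<dots> \<le> \<eta> * gibbs \<beta> (G \<beta>) w" using elim(1) by simp
          also have "\<dots> \<le> \<eta> * gibbs_set \<beta> (G \<beta>) Y"
            unfolding gibbs_set_def using w \<eta>
            by (intro mult_left_mono member_le_sum less_imp_le[OF gibbs_pos]) auto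
          finally show "gibbs \<beta> (G \<beta>) x * h x \<le> \<eta> * gibbs_set \<beta> (G \<beta>) Y" .
        qed
      qed
    qed
    then have outside: "\<forall>\<^sub>F \<beta> in at_top. \<forall>x\<in>- (Y \<union> A). \<forall>h.
        reversible_matrix.equilibrium_potential (P \<beta>) Y A h \<longrightarrow>
        reversible_matrix.energy (P \<beta>) (gibbs \<beta> (G \<beta>)) h h
          \<le> 2 * k * exp (- \<beta> * \<Gamma>) * gibbs_set \<beta> (G \<beta>) Y \<longrightarrow>
        gibbs \<beta> (G \<beta>) x * h x \<le> \<eta> * gibbs_set \<beta> (G \<beta>) Y"
      by (intro eventually_ball_finite) auto
    \<comment> \<open>Here the potential is 1 on \<open>A\<close> and 0 at \<open>y'\<close>, and
      the path runs inside the well of \<open>Y\<close>. Taking \<open>m\<close> to be the mass of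
      \<open>Y\<close> later cancels it from both sides.\<close>
    have "\<forall>\<^sub>F \<beta> in at_top. \<forall>p m. reversible_matrix.equilibrium_potential (P \<beta>) A {y'} p \<longrightarrow> 0 \<le> m \<longrightarrow>
        reversible_matrix.energy (P \<beta>) (gibbs \<beta> (G \<beta>)) p p \<le> 2 * k * exp (- \<beta> * \<Gamma>) * m \<longrightarrow>
        gibbs_set \<beta> (G \<beta>) Y * p y \<le> \<epsilon> * m" if "y \<in> Y" "y' \<in> Y" for y y'
      by (rule eventually_potential_small[OF level Y A _ connected[OF that] _ \<epsilon>]) (use k in auto)
    then have inside: "\<forall>\<^sub>F \<beta> in at_top. \<forall>y\<in>Y. \<forall>y'\<in>Y. \<forall>p m.
        reversible_matrix.equilibrium_potential (P \<beta>) A {y'} p \<longrightarrow> 0 \<le> m \<longrightarrow>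
        reversible_matrix.energy (P \<beta>) (gibbs \<beta> (G \<beta>)) p p \<le> 2 * k * exp (- \<beta> * \<Gamma>) * m \<longrightarrow>
        gibbs_set \<beta> (G \<beta>) Y * p y \<le> \<epsilon> * m"
      by (intro eventually_ball_finite ballI) auto
    from eventually_reversible_matrix cap outside inside u show ?thesis
    proof eventually_elim
      case (elim \<beta>)
      interpret reversible_matrix "P \<beta>" "gibbs \<beta> (G \<beta>)" by (rule elim(1))
      obtain h where h: "equilibrium_potential Y A h"
        using equilibrium_potential_exists[OF Y YA] by blast
      have capE: "capacity \<beta> (G \<beta>) (P \<beta>) Y A = energy h h" by (rule capacity_eq_energy[OF elim(1) h Y])
      have h_pos: "0 < energy h h"
        and h_le: "energy h h \<le> 2 * k * exp (- \<beta> * \<Gamma>) * gibbs_set \<beta> (G \<beta>) Y"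
        using elim(2) capE by auto
      let ?g = "gibbs_set \<beta> (G \<beta>) Y"
      have g: "0 < ?g" by (rule gibbs_set_pos[OF Y])
      have mass: "(\<Sum>x\<in>- Y. gibbs \<beta> (G \<beta>) x * h x) \<le> \<epsilon> * sum (gibbs \<beta> (G \<beta>)) Y"
      proof -
        have "gibbs \<beta> (G \<beta>) x * h x \<le> \<eta> * ?g" if "x \<in> - Y" for x
          using elim(3) h h_le that \<eta> g
          by (cases "x \<in> A") (auto simp: equilibrium_potential_def)
        then have "(\<Sum>x\<in>- Y. gibbs \<beta> (G \<beta>) x * h x) \<le> real (card (- Y)) * (\<eta> * ?g)"
          by (rule sum_bounded_above)
        also have "\<dots> \<le> real CARD('x) * (\<eta> * ?g)"
          using \<eta> g by (intro mult_right_mono) (auto simp: card_mono)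
        also have "\<dots> = \<epsilon> * sum (gibbs \<beta> (G \<beta>)) Y" by (simp add: \<eta>_def gibbs_set_def)
        finally show ?thesis .
      qed
      have visit: "\<exists>p. equilibrium_potential A {y'} p \<and> p y \<le> \<epsilon>" if y: "y \<in> Y" "y' \<in> Y" for y y'
      proof -
        obtain p where p: "equilibrium_potential A {y'} p"
          using equilibrium_potential_exists[OF A, of "{y'}"] y YA by blast
        \<comment> \<open>\<open>1 - h\<close> is 1 on \<open>A\<close> and 0 at \<open>y'\<close>,
          hence a competitor for \<open>p\<close>, and it has the energy of
          \<open>h\<close>.\<close>
        have "energy p p \<le> energy (\<lambda>x. 1 - h x) (\<lambda>x. 1 - h x)"
          by (rule equilibrium_potential_minimal[OF p])
            (use h y in \<open>auto simp: equilibrium_potential_def\<close>)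
        also have "\<dots> = energy h h" by (simp add: energy_def algebra_simps)
        finally have "?g * p y \<le> \<epsilon> * ?g" using elim(4) y p h_le g by (meson less_imp_le order_trans)
        then show ?thesis using p g by (auto simp: mult.commute)
      qed
      have "Q \<beta> = sum (gibbs \<beta> (G \<beta>)) Y / energy h h" by (simp add: Q_def gibbs_set_def capE)
      with hitting_system_estimate[OF elim(5) u_nonneg h w h_pos mass visit] show ?case by simp
    qed
  qed
  have "((\<lambda>\<beta>. u \<beta> w / T \<beta>) \<longlongrightarrow> 1) at_top"
  proof (rule tendstoI)
    fix e :: real assume e: "0 < e"
    \<comment> \<open>The bound 1/2 ensures \<open>(1 + \<epsilon>) * (1 + \<epsilon>) \<le> (1 -
      \<epsilon>) * (1 + 8 * \<epsilon>)\<close>; the bound \<open>e / 9\<close> makes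
      \<open>8 * \<epsilon>\<close> smaller than \<open>e\<close>.\<close>
    define \<epsilon> where "\<epsilon> = min (1 / 2) (e / 9)"
    have \<epsilon>: "0 < \<epsilon>" "\<epsilon> \<le> 1 / 2" "8 * \<epsilon> < e" using e by (auto simp: \<epsilon>_def min_def)
    have "\<forall>\<^sub>F \<beta> in at_top. dist (Q \<beta> / T \<beta>) 1 < \<epsilon>" by (rule tendstoD[OF QT \<epsilon>(1)])
    with estimate[OF \<epsilon>(1)] show "\<forall>\<^sub>F \<beta> in at_top. dist (u \<beta> w / T \<beta>) 1 < e"
    proof eventually_elim
      case (elim \<beta>)
      define q v where "q = Q \<beta> / T \<beta>" and "v = u \<beta> w / T \<beta>"
      have Qq: "Q \<beta> = q * T \<beta>" and uv: "u \<beta> w = v * T \<beta>" using T[of \<beta>] by (auto simp: q_def v_def)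
      have "((1 - \<epsilon>) * q) * T \<beta> \<le> v * T \<beta>" "((1 - \<epsilon>) * v) * T \<beta> \<le> ((1 + \<epsilon>) * q) * T \<beta>"
        using elim(1) unfolding Qq uv by (auto simp: mult.assoc)
      then have v: "(1 - \<epsilon>) * q \<le> v" "(1 - \<epsilon>) * v \<le> (1 + \<epsilon>) * q" using T[of \<beta>] by simp_all
      have q: "1 - \<epsilon> < q" "q < 1 + \<epsilon>" using elim(2) by (auto simp: q_def dist_real_def)
      have sq0: "0 \<le> \<epsilon> * \<epsilon>" by simp
      have sq: "\<epsilon> * \<epsilon> \<le> \<epsilon> * (1 / 2)" using \<epsilon> by (intro mult_left_mono) auto
      have "(1 - \<epsilon>) * (1 - \<epsilon>) \<le> (1 - \<epsilon>) * q" using q \<epsilon> by (intro mult_left_mono) auto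
      moreover have "(1 - \<epsilon>) * (1 - \<epsilon>) = 1 - 2 * \<epsilon> + \<epsilon> * \<epsilon>" by (simp add: algebra_simps)
      ultimately have lower: "1 - 2 * \<epsilon> \<le> v" using v(1) sq0 by linarith
      have "(1 + \<epsilon>) * q \<le> (1 + \<epsilon>) * (1 + \<epsilon>)" using q \<epsilon> by (intro mult_left_mono) auto
      also have "\<dots> \<le> (1 - \<epsilon>) * (1 + 8 * \<epsilon>)" using sq \<epsilon>(1) by (simp add: algebra_simps)
      finally have "(1 - \<epsilon>) * v \<le> (1 - \<epsilon>) * (1 + 8 * \<epsilon>)" using v(2) by linarith
      then have "v \<le> 1 + 8 * \<epsilon>" using \<epsilon>(2) by (simp add: mult_le_cancel_left)
      with lower \<epsilon> show ?case unfolding v_def[symmetric] by (simp add: dist_real_def abs_less_iff)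
    qed
  qed
  then show ?thesis unfolding T_def[symmetric] by (rule asymp_equivI')
qed

end

text \<open>Links expectations to the linear system. The value 0 is imposed on \<open>A\<close>
  because a chain started there would yield a return time.\<close>

lemma mean_hitting_times_hitting_system:
  assumes chain: "reversible_matrix P \<mu>" and A: "A \<noteq> {}"
    and mc: "\<And>x. markov_chain_from (M x) X P x"
  shows "reversible_matrix.hitting_system P A
      (\<lambda>x. if x \<in> A then 0 else enn2real (mean_hitting_time (M x) X A))"
    and "x \<notin> A \<Longrightarrow> mean_hitting_time (M x) X A < \<infinity>"
proof -
  interpret reversible_matrix P \<mu> by (rule chain)
  obtain u where u: "hitting_system A u" "\<And>x. 0 \<le> u x" using hitting_system_exists[OF A] by blast
  have mean: "mean_hitting_time (M x) X A = ennreal (u x)" if "x \<notin> A" for x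
  proof -
    interpret markov_chain_process "M x" X P x by standard (rule mc)
    show ?thesis
      by (rule mean_hitting_time_eq)
        (use u that in \<open>auto simp: hitting_system_def lap_def algebra_simps\<close>)
  qed
  then show "x \<notin> A \<Longrightarrow> mean_hitting_time (M x) X A < \<infinity>" by simp
  have "(\<lambda>x. if x \<in> A then 0 else enn2real (mean_hitting_time (M x) X A)) = u"
    using u mean by (auto simp: fun_eq_iff hitting_system_def)
  then show "hitting_system A (\<lambda>x. if x \<in> A then 0 else enn2real (mean_hitting_time (M x) X A))"
    using u(1) by simp
qed

text \<open>As \<open>enn2real\<close> sends infinity to 0, each asymptotic formula is paired with
  eventual finiteness. The condition \<open>n \<ge> 2\<close> expresses that at least four states
  are named.\<close>

theorem theorem2p10:
  fixes \<Delta> :: "'x::finite \<Rightarrow> 'x \<Rightarrow> ereal"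
    and P :: "real \<Rightarrow> 'x \<Rightarrow> 'x \<Rightarrow> real"
    and G :: "real \<Rightarrow> 'x \<Rightarrow> real"
    and H :: "'x \<Rightarrow> real"
    and M :: "real \<Rightarrow> 'x \<Rightarrow> 'w measure"
    and X :: "real \<Rightarrow> nat \<Rightarrow> 'w \<Rightarrow> 'x"
    and x0 x2 :: 'x and x1 :: "nat \<Rightarrow> 'x" and n :: nat
    and k1 k2 :: real
  assumes "reversible_rate_chain \<Delta> P G H"
    and "\<And>\<beta> x. \<beta> > 0 \<Longrightarrow> markov_chain_from (M \<beta> x) (X \<beta>) (P \<beta>) x"
    and "n \<ge> 2"
    and "inj_on x1 {1..n}" and "x0 \<notin> x1 ` {1..n}" and "x2 \<notin> x1 ` {1..n}" and "x0 \<noteq> x2"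
    and "stable_states H = {x0}"
    and "metastable_states \<Delta> H = insert x2 (x1 ` {1..n})"
    and "\<And>r. r \<in> {1..n} \<Longrightarrow> H x2 > H (x1 r)"
    and "\<And>r q. r \<in> {1..n} \<Longrightarrow> q \<in> {1..n} \<Longrightarrow> H (x1 r) = H (x1 q)"
    and "\<And>r q. r \<in> {1..n} \<Longrightarrow> q \<in> {1..n} \<Longrightarrow>
           comm_height \<Delta> H (x1 r) (x1 q) - ereal (H (x1 r)) < max_stability_level \<Delta> H"
    and "k1 > 0" and "k2 > 0"
    and "(\<lambda>\<beta>. gibbs \<beta> (G \<beta>) x2
               / capacity \<beta> (G \<beta>) (P \<beta>) {x2} (insert x0 (x1 ` {1..n})))
         \<sim>[at_top] (\<lambda>\<beta>. 1 / k1 * exp (\<beta> * real_of_ereal (max_stability_level \<Delta> H)))"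
    and "(\<lambda>\<beta>. gibbs_set \<beta> (G \<beta>) (x1 ` {1..n})
               / capacity \<beta> (G \<beta>) (P \<beta>) (x1 ` {1..n}) {x0})
         \<sim>[at_top] (\<lambda>\<beta>. 1 / k2 * exp (\<beta> * real_of_ereal (max_stability_level \<Delta> H)))"
  shows "((\<forall>\<^sub>F \<beta> in at_top.
             mean_hitting_time (M \<beta> x2) (X \<beta>) (insert x0 (x1 ` {1..n})) < \<infinity>) \<and>
          (\<lambda>\<beta>. enn2real (mean_hitting_time (M \<beta> x2) (X \<beta>) (insert x0 (x1 ` {1..n}))))
            \<sim>[at_top] (\<lambda>\<beta>. exp (\<beta> * real_of_ereal (max_stability_level \<Delta> H)) * (1 / k1)))
       \<and> (\<forall>r\<in>{1..n}.
           (\<forall>\<^sub>F \<beta> in at_top. mean_hitting_time (M \<beta> (x1 r)) (X \<beta>) {x0} < \<infinity>) \<and>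
           (\<lambda>\<beta>. enn2real (mean_hitting_time (M \<beta> (x1 r)) (X \<beta>) {x0}))
             \<sim>[at_top] (\<lambda>\<beta>. exp (\<beta> * real_of_ereal (max_stability_level \<Delta> H)) * (1 / k2)))"
proof -
  interpret reversible_rate_chain \<Delta> P G H by (rule assms(1))
  note mc = assms(2)
  define Y where "Y = x1 ` {1..n}"
  define A where "A = insert x0 Y"
  have H_x2: "H y < H x2" if "y \<in> Y" for y using assms(10) that by (auto simp: Y_def)
  have x0: "x0 \<notin> Y" and x2: "x2 \<notin> A" "x2 \<notin> Y" and Y: "Y \<noteq> {}"
    using assms(3,5,6,7) by (auto simp: Y_def A_def)
  have stable: "stable_states H = {x0}" by (rule assms(8))
  have lower: "lower_states H x \<noteq> {}" if "x \<noteq> x0" for x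
  proof -
    have "x \<notin> stable_states H" using that stable by simp
    then show ?thesis by (auto simp: stable_states_def lower_states_def not_le)
  qed
  have metastable: "metastable_states \<Delta> H = insert x2 Y" unfolding Y_def by (rule assms(9))
  \<comment> \<open>\<open>x2\<close> is metastable but not the global minimum, so the maximal
    stability level is its own and is a real number.\<close>
  have "x2 \<in> metastable_states \<Delta> H" using metastable by simp
  then have "max_stability_level \<Delta> H = stability_level \<Delta> H x2" by (simp add: metastable_states_def)
  moreover obtain \<Gamma> where "stability_level \<Delta> H x2 = ereal \<Gamma>"
    by (rule stability_level_finite[OF irreducible lower[OF assms(7)[symmetric]]])
  ultimately have \<Gamma>: "max_stability_level \<Delta> H = ereal \<Gamma>" by simp
  have less: "stability_level \<Delta> H x < ereal \<Gamma>" if "x \<notin> insert x0 (insert x2 Y)" for x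
  proof -
    have "stability_level \<Delta> H x \<le> max_stability_level \<Delta> H"
      unfolding max_stability_level_def using that stable by (intro Max_ge) auto
    moreover have "stability_level \<Delta> H x \<noteq> max_stability_level \<Delta> H"
      using that metastable by (auto simp: metastable_states_def)
    ultimately show ?thesis by (simp add: \<Gamma>)
  qed
  have mean: "(\<forall>\<^sub>F \<beta> in at_top. mean_hitting_time (M \<beta> w) (X \<beta>) B < \<infinity>) \<and>
      (\<lambda>\<beta>. enn2real (mean_hitting_time (M \<beta> w) (X \<beta>) B)) \<sim>[at_top] (\<lambda>\<beta>. exp (\<beta> * \<Gamma>) * (1 / k))"
    if B: "B \<noteq> {}" "Z \<inter> B = {}" "0 < k" and w: "w \<in> Z" and level: "\<forall>y\<in>Z. H y = H w"
      and connected: "\<And>y y'. y \<in> Z \<Longrightarrow> y' \<in> Z \<Longrightarrow> (y, y') \<in> (edges_below \<Delta> H (H w + \<Gamma>))\<^sup>*"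
      and drain: "\<And>x. x \<notin> Z \<union> B \<Longrightarrow> H x \<le> H w \<Longrightarrow> \<exists>z\<in>B. (x, z) \<in> (edges_below \<Delta> H (H x + \<Gamma>))\<^sup>*"
      and asymp: "(\<lambda>\<beta>. gibbs_set \<beta> (G \<beta>) Z / capacity \<beta> (G \<beta>) (P \<beta>) Z B)
        \<sim>[at_top] (\<lambda>\<beta>. 1 / k * exp (\<beta> * \<Gamma>))"
    for B Z k w
  proof -
    let ?u = "\<lambda>\<beta> x. if x \<in> B then 0 else enn2real (mean_hitting_time (M \<beta> x) (X \<beta>) B)"
    have wB: "w \<notin> B" using w B(2) by blast
    have "\<forall>\<^sub>F \<beta> in at_top. reversible_matrix.hitting_system (P \<beta>) B (?u \<beta>) \<and>
        mean_hitting_time (M \<beta> w) (X \<beta>) B < \<infinity>"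
      using eventually_reversible_matrix eventually_gt_at_top[of "0 :: real"]
      by eventually_elim (use mean_hitting_times_hitting_system[OF _ B(1) mc] wB in blast)
    then have hs: "\<forall>\<^sub>F \<beta> in at_top. reversible_matrix.hitting_system (P \<beta>) B (?u \<beta>)"
      and fin: "\<forall>\<^sub>F \<beta> in at_top. mean_hitting_time (M \<beta> w) (X \<beta>) B < \<infinity>"
      by (auto simp: eventually_conj_iff)
    have "(\<lambda>\<beta>. ?u \<beta> w) \<sim>[at_top] (\<lambda>\<beta>. exp (\<beta> * \<Gamma>) * (1 / k))"
      by (rule hitting_system_asymp_equiv[OF B w level connected drain asymp hs]) auto
    with fin wB show ?thesis by simp
  qed
  have first: "(\<forall>\<^sub>F \<beta> in at_top. mean_hitting_time (M \<beta> x2) (X \<beta>) A < \<infinity>) \<and>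
      (\<lambda>\<beta>. enn2real (mean_hitting_time (M \<beta> x2) (X \<beta>) A)) \<sim>[at_top] (\<lambda>\<beta>. exp (\<beta> * \<Gamma>) * (1 / k1))"
  proof (rule mean[where Z = "{x2}"])
    \<comment> \<open>\<open>x\<close> differs from \<open>x2\<close> and every later state is
      strictly lower than \<open>x\<close>, so before reaching \<open>A\<close> the descent meets
      only states covered by \<open>less\<close>.\<close>
    fix x assume x: "x \<notin> {x2} \<union> A" "H x \<le> H x2"
    show "\<exists>z\<in>A. (x, z) \<in> (edges_below \<Delta> H (H x + \<Gamma>))\<^sup>*"
      by (rule descent, rule less) (use x in \<open>auto simp: A_def\<close>)
  next
    show "(\<lambda>\<beta>. gibbs_set \<beta> (G \<beta>) {x2} / capacity \<beta> (G \<beta>) (P \<beta>) {x2} A)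
        \<sim>[at_top] (\<lambda>\<beta>. 1 / k1 * exp (\<beta> * \<Gamma>))"
      using assms(15) by (simp only: A_def Y_def \<Gamma> real_of_ereal.simps gibbs_set_def sum.insert
        finite.emptyI empty_iff not_False_eq_True sum.empty add_0_right)
    show "A \<noteq> {}" by (simp add: A_def)
    show "{x2} \<inter> A = {}" using x2(1) by simp
    show "0 < k1" by (rule assms(13))
  qed auto
  have same: "H y = H y'" if "y \<in> Y" "y' \<in> Y" for y y'
    using that assms(11) unfolding Y_def by blast
  have second: "(\<forall>\<^sub>F \<beta> in at_top. mean_hitting_time (M \<beta> w) (X \<beta>) {x0} < \<infinity>) \<and>
      (\<lambda>\<beta>. enn2real (mean_hitting_time (M \<beta> w) (X \<beta>) {x0})) \<sim>[at_top] (\<lambda>\<beta>. exp (\<beta> * \<Gamma>) * (1 / k2))"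
    if w: "w \<in> Y" for w
  proof (rule mean[where Z = Y])
    show "\<forall>y\<in>Y. H y = H w" using w same by blast
    show "(y, y') \<in> (edges_below \<Delta> H (H w + \<Gamma>))\<^sup>*" if "y \<in> Y" "y' \<in> Y" for y y'
    proof -
      have "comm_height \<Delta> H y y' - ereal (H y) < ereal \<Gamma>"
        using that assms(12) by (auto simp: Y_def \<Gamma>)
      then have "comm_height \<Delta> H y y' < ereal (H y + \<Gamma>)" by (simp add: ereal_minus_less add.commute)
      then show ?thesis unfolding same[OF w that(1)] by (rule comm_height_less_imp_rtrancl)
    qed
    show "(\<lambda>\<beta>. gibbs_set \<beta> (G \<beta>) Y / capacity \<beta> (G \<beta>) (P \<beta>) Y {x0})
        \<sim>[at_top] (\<lambda>\<beta>. 1 / k2 * exp (\<beta> * \<Gamma>))"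
      using assms(16) by (simp only: Y_def \<Gamma> real_of_ereal.simps)
    show "Y \<inter> {x0} = {}" using x0 by simp
    show "0 < k2" by (rule assms(14))
    show "w \<in> Y" by (rule w)
  next
    fix x assume x: "x \<notin> Y \<union> {x0}" "H x \<le> H w"
    show "\<exists>z\<in>{x0}. (x, z) \<in> (edges_below \<Delta> H (H x + \<Gamma>))\<^sup>*"
    proof (rule descent, rule less)
      \<comment> \<open>The descent stays no higher than \<open>w\<close> and so avoids
        \<open>x2\<close>. It avoids \<open>Y\<close> as well, since \<open>x\<close> lies outside
        \<open>Y\<close> and later states are strictly lower.\<close>
      fix y assume y: "y \<notin> {x0}" "y = x \<or> H y < H x"
      have "y \<noteq> x2" using y x H_x2[OF w] by auto
      moreover have "y \<notin> Y"
      proof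
        assume "y \<in> Y"
        then have "H y = H w" using w by (rule same)
        then show False using y x \<open>y \<in> Y\<close> by auto
      qed
      ultimately show "y \<notin> insert x0 (insert x2 Y)" using y by simp
    qed
  qed auto
  have "\<forall>r\<in>{1..n}. x1 r \<in> Y" by (simp add: Y_def)
  then show ?thesis
    using first second unfolding A_def[unfolded Y_def] \<Gamma> real_of_ereal.simps by blast
qed

end
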